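(* The generating function $A(x,w,v,q)=\sum_{i\ge1}\sum_{s\ge1}\sum_{t\ge1}\sum_{n\geq s+t+2i-2} a_i(n,s,t)\,x^nw^tv^sq^i$ is given by $$A(x,w,v,q)=q\sum_{j\ge0}\frac{w\sqrt{x}\,q^{j}\left(A(x,vL_{j}(x,w))-A(x,v)-\dfrac{q\sum_{i\ge0}\frac{q^{i}\left(A(x,vL_{i}(x,1))-A(x,v)\right)}{\sqrt{x}\,U_{i+2}(t)U_{i+1}(t)}}{1+q\sum_{i\ge0}\frac{q^{i}}{\sqrt{x}\,U_{i+2}(t)U_{i+1}(t)}}\right)}{\left(U_{j+1}(t)-w\sqrt{x}\,U_j(t)\right)\left(U_{j}(t)-w\sqrt{x}\,U_{j-1}(t)\right)},$$ where on the right-hand side $t=\frac{1}{2\sqrt{x}}$, $A(x,v)=\frac{xv}{1-xvC(x)}$, and $L_j(x,w)=\frac{1}{1-xL_{j-1}(x,w)}$ for $j\ge1$, with $L_0(x,w)=\frac{1}{1-xw}$.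
   Context: For a positive integer $n$, $\mathcal{L}_n$ denotes the set of all words $a=(a_1,a_2,\ldots,a_n)$ over the alphabet of non-negative integers satisfying: (i) $a_{i+1}\ge a_i-1$ for $1\le i<n$; and (ii) if $a_i=k>0$ with $i$ minimal (i.e. $i$ is the position of the left-most occurrence of the letter $k$), then there exist $i_1<i<i_2$ such that $a_{i_1}=a_{i_2}=k-1$. For $i\ge1$, $s\ge1$, $t\ge1$, $a_i(n,s,t)$ is the number of words in $\mathcal{L}_n$ containing exactly $s$ occurrences of the letter $i$ and exactly $t$ zeros (it is $0$ unless $n\ge2$, $1\le i\le\lfloor\frac{n-1}{2}\rfloor$, $2\le t\le n$ and $1\le s\le n-t-2i+2$). $C(x)=\sum_{n\ge0}C_nx^n=\frac{1-\sqrt{1-4x}}{2x}$, where $C_n=\frac{1}{n+1}\binom{2n}{n}$ is the $n$-th Catalan number. $U_n$ are the Chebyshev polynomials of the second kind: $U_0(y)=1$, $U_1(y)=2y$, $U_n(y)=2yU_{n-1}(y)-U_{n-2}(y)$ for $n\ge2$, with $U_{-1}(y)=0$ (extending the recurrence). The two-variable series $A(x,v)$ and the four-variable series $A(x,w,v,q)$ are distinct objects distinguished by their number of arguments. Identities are of formal series in $x$ (expansions taken in powers of $\sqrt{x}$, the infinite sums converging in that sense). *)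

theory Defs
  imports
    "HOL-Analysis.Infinite_Sum"
    "HOL-Computational_Algebra.Computational_Algebra"
begin

(* Words a_1 ... a_n are lists, so letter a_i is at list index i - 1.
   "a ! i \<le> a ! Suc i + 1" is the condition a_{i+1} \<ge> a_i - 1 without truncated subtraction. *)
definition words_L :: "nat \<Rightarrow> nat list set" where
  "words_L n = {a. length a = n \<and>
     (\<forall>i. Suc i < n \<longrightarrow> a ! i \<le> a ! Suc i + 1) \<and>
     (\<forall>i<n. a ! i > 0 \<and> (\<forall>j<i. a ! j \<noteq> a ! i) \<longrightarrow>
        (\<exists>i1 i2. i1 < i \<and> i < i2 \<and> i2 < n \<and> a ! i1 = a ! i - 1 \<and> a ! i2 = a ! i - 1))}"

(* num_words i n s t is a_i(n, s, t). *)
definition num_words :: "nat \<Rightarrow> nat \<Rightarrow> nat \<Rightarrow> nat \<Rightarrow> nat" where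
  "num_words i n s t = card {a \<in> words_L n. count_list a i = s \<and> count_list a 0 = t}"

definition catalan :: "nat \<Rightarrow> nat" where
  "catalan n = ((2 * n) choose n) div (n + 1)"

fun chebyshev_U_nat :: "nat \<Rightarrow> 'a::comm_ring_1 \<Rightarrow> 'a" where
  "chebyshev_U_nat 0 y = 1"
| "chebyshev_U_nat (Suc 0) y = 2 * y"
| "chebyshev_U_nat (Suc (Suc n)) y = 2 * y * chebyshev_U_nat (Suc n) y - chebyshev_U_nat n y"

(* Integer index because U_{-1} = 0 is needed; values at indices below -1 are irrelevant. *)
definition chebyshev_U :: "int \<Rightarrow> 'a::comm_ring_1 \<Rightarrow> 'a" where
  "chebyshev_U k y = (if k < 0 then 0 else chebyshev_U_nat (nat k) y)"

(* All series live in the field of formal Laurent series in the indeterminate sqrt x;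
   the library metric on this type is the one given by the order in that indeterminate,
   so sums below converge in the sense of formal series in sqrt x. *)
definition sqrt_x :: "'a::field fls" where
  "sqrt_x = fls_X"

definition x_ser :: "'a::field fls" where
  "x_ser = sqrt_x ^ 2"

(* The Catalan series C(x) at x = (sqrt x)^2, hence the exponent doubling. *)
definition C_ser :: "'a::field fls" where
  "C_ser = fls_compose_power (fps_to_fls (Abs_fps (\<lambda>n. of_nat (catalan n)))) 2"

(* A2 v is A(x, v) and, below, A4 w v q is A(x, w, v, q); the arguments are themselves
   series, so that substitutions such as A(x, v L_j(x, w)) are function application. *)
definition A2 :: "'a::field fls \<Rightarrow> 'a fls" where
  "A2 v = x_ser * v / (1 - x_ser * v * C_ser)"

primrec L_ser :: "nat \<Rightarrow> 'a::field fls \<Rightarrow> 'a fls" where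
  "L_ser 0 w = 1 / (1 - x_ser * w)"
| "L_ser (Suc j) w = 1 / (1 - x_ser * L_ser j w)"

definition A4_index :: "(nat \<times> nat \<times> nat \<times> nat) set" where
  "A4_index = {(i, s, t, n). 1 \<le> i \<and> 1 \<le> s \<and> 1 \<le> t \<and> s + t + 2 * i - 2 \<le> n}"

definition A4_term :: "'a::field fls \<Rightarrow> 'a fls \<Rightarrow> 'a fls \<Rightarrow> nat \<times> nat \<times> nat \<times> nat \<Rightarrow> 'a fls" where
  "A4_term w v q = (\<lambda>(i, s, t, n). of_nat (num_words i n s t) * x_ser ^ n * w ^ t * v ^ s * q ^ i)"

definition A4 :: "'a::field fls \<Rightarrow> 'a fls \<Rightarrow> 'a fls \<Rightarrow> 'a fls" where
  "A4 w v q = infsum (A4_term w v q) A4_index"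

(* The coefficient field Q(w, v, q): fractions of polynomials in three nested indeterminates,
   embedded as the constants of the Laurent series in sqrt x. *)
type_synonym coeff_field = "rat poly poly poly fract"

definition w_var :: "coeff_field fls" where
  "w_var = fls_const (Fract [:0, 1:] 1)"

definition v_var :: "coeff_field fls" where
  "v_var = fls_const (Fract [:[:0, 1:]:] 1)"

definition q_var :: "coeff_field fls" where
  "q_var = fls_const (Fract [:[:[:0, 1:]:]:] 1)"

end

theory Submission
  imports Defs "HOL-Analysis.Elementary_Metric_Spaces"
begin

text \<open>
  Deleting the zeros of a word of \<open>\<L>\<close> and lowering every other letter by one gives a shorter word
  of \<open>\<L>\<close> (or the empty word); call it the peeled word. Conversely, the words above a given nonempty
  peeled word \<open>b\<close> arise by raising its letters by one and putting at least one zero in front and arbitrarily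
  many zeros after each letter that was \<open>0\<close> in \<open>b\<close>, the only constraint being that at least one zero is inserted after
  some letter (\<open>L_word_peel_iff\<close>). Every inserted zero weighs \<open>xw\<close>, so a peeled word with \<open>r\<close> zeros completed
  to words by zeros of total weight \<open>xw/(1-xw) (L\<^sup>r - 1)\<close> with \<open>L = L\<^sub>0(x,w) = 1/(1-xw)\<close>. Since the
  letter \<open>i+1\<close> of a word is the letter \<open>i\<close> of the peeled word, the generating function
  \<open>F\<^sub>i(w,v)\<close> of all words, with \<open>w\<close> marking zeros and \<open>v\<close> marking the letter \<open>i\<close>, satisfies
  \<open>F\<^sub>i\<^sub>+\<^sub>1(w,v) = xw L (1 + F\<^sub>i(L,v) - F\<^sub>i(1,v))\<close>  (\<open>letter_gf_Suc\<close>).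

  For \<open>v = 1\<close> all the \<open>F\<^sub>i\<close> agree, and the relation becomes an equation for one unknown function of
  \<open>w\<close>. It is contracting for the order in \<open>x\<close>, so it has only one solution; the closed form \<open>A(x,w)\<close> solves it because
  \<open>C = 1 + xC\<^sup>2\<close>, whence \<open>F\<^sub>0(w,v) = A(x,vw)\<close> (\<open>letter_gf_0_eq_A2\<close>). Removing the words without the
  marked letter (\<open>v = 0\<close>) and summing \<open>q\<^sup>i\<close> times the result over \<open>i \<ge> 1\<close> gives
  \<open>A(w) = q xwL (A(x,vL) - A(x,v) + A(L) - A(1))\<close>, where \<open>A(w)\<close> is short for \<open>A(x,w,v,q)\<close>
  (\<open>A4_functional\<close>).

  Iterating along \<open>w, L\<^sub>0, L\<^sub>1, \<dots>\<close> expresses \<open>A(w)\<close> as a series in which \<open>A(1)\<close> is the only unknown;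
  the remainder tends to zero because each step gains a factor \<open>x\<close>. The iterates are convergents of a
  continued fraction, \<open>L\<^sub>j = D\<^sub>j/(\<surd>x D\<^sub>j\<^sub>+\<^sub>1)\<close> with \<open>D\<^sub>j = U\<^sub>j - w\<surd>x U\<^sub>j\<^sub>-\<^sub>1\<close>, so the accumulated
  factors telescope to \<open>w\<surd>x/(D\<^sub>j\<^sub>+\<^sub>1 D\<^sub>j)\<close>. At \<open>w = 1\<close> one has \<open>D\<^sub>j = \<surd>x U\<^sub>j\<^sub>+\<^sub>1\<close>, and the series is a
  linear equation for \<open>A(1)\<close>, whose solution is the quotient in the statement (\<open>A4_at_1\<close>).
\<close>

section \<open>Laurent series: order of vanishing and convergence\<close>

(* coefficients of Laurent series ($$) and of power series ($) *)
unbundle fps_syntax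
unbundle Formal_Power_Series.fps_syntax

text \<open>
  Divisibility of a Laurent series by the \<open>N\<close>-th power of the indeterminate. In contrast to a bound on
  \<open>fls_subdegree\<close>, it needs no exception for the zero series. Series with \<open>ord_ge 0\<close> form the ring of
  power series, in which all substitutions below take place.
\<close>

definition ord_ge :: "int \<Rightarrow> 'a::zero fls \<Rightarrow> bool" where
  "ord_ge N f \<longleftrightarrow> (\<forall>n<N. f $$ n = 0)"

lemma ord_ge_iff_subdegree: "ord_ge N f \<longleftrightarrow> f = 0 \<or> N \<le> fls_subdegree f"
  unfolding ord_ge_def
  by (metis fls_eq0_below_subdegree fls_subdegree_geI fls_zero_nth less_le_trans)

lemma ord_ge_0 [simp]: "ord_ge N 0"
  by (simp add: ord_ge_def)

lemma ord_ge_mono: "ord_ge N f \<Longrightarrow> M \<le> N \<Longrightarrow> ord_ge M f"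
  by (auto simp: ord_ge_def)

lemma ord_ge_add: "ord_ge N f \<Longrightarrow> ord_ge N g \<Longrightarrow> ord_ge N (f + g)"
  by (auto simp: ord_ge_def)

lemma ord_ge_uminus [simp]: "ord_ge N (- f) \<longleftrightarrow> ord_ge N (f :: 'a::group_add fls)"
  by (auto simp: ord_ge_def)

lemma ord_ge_diff: "ord_ge N f \<Longrightarrow> ord_ge N g \<Longrightarrow> ord_ge N (f - g :: 'a::group_add fls)"
  by (auto simp: ord_ge_def)

lemma ord_ge_sum: "(\<And>x. x \<in> A \<Longrightarrow> ord_ge N (f x)) \<Longrightarrow> ord_ge N (sum f A)"
  by (induction A rule: infinite_finite_induct) (auto intro: ord_ge_add)

lemma ord_ge_mult:
  fixes f g :: "'a::comm_ring_1 fls"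
  assumes "ord_ge M f" "ord_ge N g"
  shows "ord_ge (M + N) (f * g)"
proof (cases "f = 0 \<or> g = 0")
  case False
  then have "M \<le> fls_subdegree f" "N \<le> fls_subdegree g"
    using assms by (auto simp: ord_ge_iff_subdegree)
  then show ?thesis
    by (auto simp: ord_ge_def intro!: fls_times_nth_eq0)
qed auto

lemma ord_ge_mult_integral:
  fixes f g :: "'a::comm_ring_1 fls"
  shows "ord_ge 0 f \<Longrightarrow> ord_ge N g \<Longrightarrow> ord_ge N (f * g)"
  using ord_ge_mult[of 0 f N g] by simp

lemma ord_ge_mult_integral':
  fixes f g :: "'a::comm_ring_1 fls"
  shows "ord_ge N f \<Longrightarrow> ord_ge 0 g \<Longrightarrow> ord_ge N (f * g)"
  using ord_ge_mult[of N f 0 g] by simp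

lemma ord_ge_1 [simp]: "ord_ge 0 (1 :: 'a::comm_ring_1 fls)"
  by (simp add: ord_ge_def)

lemma ord_ge_const [simp]: "ord_ge 0 (fls_const c)"
  by (simp add: ord_ge_def)

lemma ord_ge_power: "ord_ge 0 (f :: 'a::comm_ring_1 fls) \<Longrightarrow> ord_ge 0 (f ^ n)"
  by (induction n) (auto intro: ord_ge_mult_integral)

lemma ord_ge_x [simp]: "ord_ge 2 (x_ser :: 'a::field fls)"
  by (auto simp: ord_ge_def x_ser_def sqrt_x_def fls_X_power_nth)

lemma ord_ge_x_power [simp]: "ord_ge (2 * int n) (x_ser ^ n :: 'a::field fls)"
  by (auto simp: ord_ge_def x_ser_def sqrt_x_def fls_X_power_nth simp flip: power_mult)

lemma x_ser_neq_0 [simp]: "x_ser \<noteq> (0 :: 'a::field fls)"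
  by (simp add: x_ser_def sqrt_x_def)

lemma ord_ge_x_mult: "ord_ge 0 w \<Longrightarrow> ord_ge 2 (x_ser * w :: 'a::field fls)"
  by (rule ord_ge_mult_integral') auto

text \<open>
  The constant term of \<open>1 - f\<close> is \<open>1\<close>, so its inverse is again a power series.
\<close>

lemma one_minus_unit:
  fixes f :: "'a::field fls"
  assumes "ord_ge 1 f"
  shows "1 - f \<noteq> 0" "ord_ge 0 (1 / (1 - f))"
proof -
  have 0: "(1 - f) $$ 0 = 1" and neg: "\<And>n. n < 0 \<Longrightarrow> (1 - f) $$ n = 0"
    using assms by (auto simp: ord_ge_def)
  from 0 show nz: "1 - f \<noteq> 0" by auto
  have "fls_subdegree (1 - f) = 0"
    using 0 neg by (intro fls_subdegree_eqI) auto
  then have "fls_subdegree (inverse (1 - f)) = 0" by simp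
  then show "ord_ge 0 (1 / (1 - f))"
    by (simp add: ord_ge_iff_subdegree inverse_eq_divide)
qed

lemma one_minus_x_unit:
  fixes w :: "'a::field fls"
  assumes "ord_ge 0 w"
  shows "1 - x_ser * w \<noteq> 0" "ord_ge 0 (1 / (1 - x_ser * w))"
  using one_minus_unit[of "x_ser * w"] ord_ge_x_mult[OF assms] ord_ge_mono by force+

lemma ord_ge_imp_eq_0: "(\<And>n. ord_ge (int n) f) \<Longrightarrow> f = 0"
proof (rule fls_eqI)
  fix k
  assume "\<And>n. ord_ge (int n) f"
  from this[of "Suc (nat k)"] show "f $$ k = 0 $$ k" by (auto simp: ord_ge_def)
qed

lemma dist_fls_less_iff:
  "dist f g < inverse (2 ^ k) \<longleftrightarrow> ord_ge (int k + 1) (f - g :: 'a::group_add fls)"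
proof (cases "f = g")
  case False
  then have nz: "f - g \<noteq> 0" by simp
  show ?thesis
  proof (cases "fls_subdegree (f - g) \<ge> 0")
    case True
    then have "dist f g < inverse (2 ^ k) \<longleftrightarrow> inverse (2 ^ nat (fls_subdegree (f - g)) :: real) < inverse (2 ^ k)"
      using False by (simp add: dist_fls_def)
    also have "\<dots> \<longleftrightarrow> k < nat (fls_subdegree (f - g))" by simp
    finally show ?thesis using nz True by (auto simp: ord_ge_iff_subdegree)
  next
    case neg: False
    have "inverse (2 ^ k :: real) \<le> 1" by (simp add: field_simps)
    moreover have "1 \<le> (2 ^ nat (- fls_subdegree (f - g)) :: real)" by simp
    ultimately show ?thesis
      using False nz neg by (auto simp: dist_fls_def ord_ge_iff_subdegree simp del: one_le_power)
  qed
qed auto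

text \<open>
  Convergence in the metric of Laurent series is stabilisation of every initial segment of coefficients.
  All limits below are computed from this description.
\<close>

lemma tendsto_fls_iff:
  fixes f :: "'b \<Rightarrow> 'a::group_add fls"
  shows "(f \<longlongrightarrow> l) F \<longleftrightarrow> (\<forall>N. eventually (\<lambda>x. ord_ge N (f x - l)) F)"
proof
  assume lim: "(f \<longlongrightarrow> l) F"
  show "\<forall>N. eventually (\<lambda>x. ord_ge N (f x - l)) F"
  proof
    fix N :: int
    have "eventually (\<lambda>x. dist (f x) l < inverse (2 ^ nat N)) F"
      by (intro tendstoD[OF lim]) simp
    then show "eventually (\<lambda>x. ord_ge N (f x - l)) F"
      unfolding dist_fls_less_iff by eventually_elim (erule ord_ge_mono, simp)
  qed
next
  assume ev: "\<forall>N. eventually (\<lambda>x. ord_ge N (f x - l)) F"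
  show "(f \<longlongrightarrow> l) F"
  proof (rule tendstoI)
    fix e :: real assume "e > 0"
    then obtain k where k: "inverse (2 ^ k) < e"
      using real_arch_pow_inv[of e "1/2"] by (auto simp: power_one_over inverse_eq_divide)
    have "eventually (\<lambda>x. ord_ge (int k + 1) (f x - l)) F" using ev by blast
    then show "eventually (\<lambda>x. dist (f x) l < e) F"
      unfolding dist_fls_less_iff[symmetric] by eventually_elim (use k in linarith)
  qed
qed

instance fls :: (ab_group_add) topological_ab_group_add
proof
  fix a b :: "'a fls"
  have "eventually (\<lambda>x. ord_ge N (fst x + snd x - (a + b))) (nhds a \<times>\<^sub>F nhds b)" for N
  proof -
    have near: "eventually (\<lambda>y. ord_ge N (y - c)) (nhds c)" for c :: "'a fls"
      using filterlim_ident[of "nhds c"] by (simp add: tendsto_fls_iff)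
    have "eventually (\<lambda>x. ord_ge N (fst x - a) \<and> ord_ge N (snd x - b)) (nhds a \<times>\<^sub>F nhds b)"
      by (intro eventually_prodI near)
    then show ?thesis
      by eventually_elim (simp add: ord_ge_def algebra_simps)
  qed
  then show "LIM x (nhds a \<times>\<^sub>F nhds b). fst x + snd x :> nhds (a + b)"
    by (simp add: tendsto_fls_iff)
  have "eventually (\<lambda>y. ord_ge N (- y - (- a))) (nhds a)" for N
  proof -
    have "eventually (\<lambda>y. ord_ge N (y - a)) (nhds a)"
      using filterlim_ident[of "nhds a"] by (simp add: tendsto_fls_iff)
    then show ?thesis
      by eventually_elim (simp add: ord_ge_def)
  qed
  then show "(uminus \<longlongrightarrow> - a) (nhds a)"
    by (simp add: tendsto_fls_iff)
qed

text \<open>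
  Multiplication is continuous although factors may have poles: an error of order \<open>M\<close> in one factor
  causes an error of order at least \<open>M\<close> plus the (possibly negative) order of the other factor.
\<close>

instance fls :: (comm_ring_1) topological_semigroup_mult
proof
  fix a b :: "'a fls"
  have "eventually (\<lambda>x. ord_ge N (fst x * snd x - a * b)) (nhds a \<times>\<^sub>F nhds b)" for N
  proof -
    \<comment> \<open>The minimum with \<open>0\<close> makes \<open>M\<close> large enough for the product of the two errors as well.\<close>
    define A where "A = min 0 (fls_subdegree a)"
    define B where "B = min 0 (fls_subdegree b)"
    define M where "M = max 0 (N - A - B)"
    have A: "ord_ge A a" and B: "ord_ge B b"
      by (auto simp: ord_ge_iff_subdegree A_def B_def)
    have near: "eventually (\<lambda>y. ord_ge M (y - c)) (nhds c)" for c :: "'a fls"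
      using filterlim_ident[of "nhds c"] by (simp add: tendsto_fls_iff)
    have "eventually (\<lambda>x. ord_ge M (fst x - a) \<and> ord_ge M (snd x - b)) (nhds a \<times>\<^sub>F nhds b)"
      by (intro eventually_prodI near)
    then show ?thesis
    proof eventually_elim
      case (elim x)
      have M: "N \<le> M + M" "N \<le> A + M" "N \<le> M + B"
        unfolding M_def A_def B_def by linarith+
      have "ord_ge N ((fst x - a) * (snd x - b))"
        by (rule ord_ge_mono[OF ord_ge_mult M(1)]) (use elim in auto)
      moreover have "ord_ge N (a * (snd x - b))"
        by (rule ord_ge_mono[OF ord_ge_mult M(2)]) (use elim A in auto)
      moreover have "ord_ge N ((fst x - a) * b)"
        by (rule ord_ge_mono[OF ord_ge_mult M(3)]) (use elim B in auto)
      ultimately have "ord_ge N ((fst x - a) * (snd x - b) + a * (snd x - b) + (fst x - a) * b)"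
        by (intro ord_ge_add)
      then show ?case by (simp add: algebra_simps)
    qed
  qed
  then show "LIM x (nhds a \<times>\<^sub>F nhds b). fst x * snd x :> nhds (a * b)"
    by (simp add: tendsto_fls_iff)
qed

text \<open>
  In this topology a family of power series is summable as soon as its members tend to zero: every
  coefficient of the sum is then a finite sum.
\<close>

lemma fls_summable_onI:
  fixes f :: "'b \<Rightarrow> 'a::ab_group_add fls"
  assumes int: "\<And>x. x \<in> A \<Longrightarrow> ord_ge 0 (f x)"
    and fin: "\<And>N. finite {x \<in> A. \<not> ord_ge (int N) (f x)}"
  shows "f summable_on A"
proof -
  define B where "B = (\<lambda>N. {x \<in> A. \<not> ord_ge (int N) (f x)})"
  define S where "S = fps_to_fls (Abs_fps (\<lambda>n. \<Sum>x\<in>B (Suc n). f x $$ int n))"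
  have "eventually (\<lambda>F. ord_ge M (sum f F - S)) (finite_subsets_at_top A)" for M
    unfolding eventually_finite_subsets_at_top
  proof (intro exI[of _ "B (nat M)"] conjI allI impI)
    show "finite (B (nat M))" unfolding B_def by (rule fin)
    show "B (nat M) \<subseteq> A" by (auto simp: B_def)
  next
    fix F assume F: "finite F \<and> B (nat M) \<subseteq> F \<and> F \<subseteq> A"
    show "ord_ge M (sum f F - S)"
      unfolding ord_ge_def
    proof (intro allI impI)
      fix n assume n: "n < M"
      show "(sum f F - S) $$ n = 0"
      proof (cases "n < 0")
        case True
        have "ord_ge 0 (sum f F)" using F int by (intro ord_ge_sum) auto
        with True show ?thesis by (simp add: S_def ord_ge_def)
      next
        case False
        then have sub: "B (Suc (nat n)) \<subseteq> F"
          using n F ord_ge_mono[of "int (nat M)" _ "int (Suc (nat n))"] unfolding B_def by auto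
        have "sum f F $$ n = (\<Sum>x\<in>F. f x $$ n)"
          by (rule fls_nth_sum)
        also have "\<dots> = (\<Sum>x\<in>B (Suc (nat n)). f x $$ n)"
          using F sub False by (intro sum.mono_neutral_right) (force simp: B_def ord_ge_def)+
        also have "\<dots> = S $$ n"
          using False by (simp add: S_def)
        finally show ?thesis by simp
      qed
    qed
  qed
  then have "(f has_sum S) A"
    by (simp add: has_sum_def tendsto_fls_iff)
  then show ?thesis by (rule has_sum_imp_summable)
qed

lemma has_sum_ord_ge:
  fixes f :: "'b \<Rightarrow> 'a::ab_group_add fls"
  assumes "(f has_sum S) A" "\<And>x. x \<in> A \<Longrightarrow> ord_ge N (f x)"
  shows "ord_ge N S"
proof -
  have "eventually (\<lambda>F. ord_ge N (sum f F - S)) (finite_subsets_at_top A)"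
    using assms(1) by (simp add: has_sum_def tendsto_fls_iff)
  then obtain F where "finite F" "F \<subseteq> A" "ord_ge N (sum f F - S)"
    unfolding eventually_finite_subsets_at_top by blast
  moreover have "ord_ge N (sum f F)" using \<open>F \<subseteq> A\<close> assms(2) by (intro ord_ge_sum) auto
  ultimately show ?thesis
    using ord_ge_diff[of N "sum f F" "sum f F - S"] by simp
qed

lemma has_sum_diff:
  fixes f g :: "'b \<Rightarrow> 'a::topological_ab_group_add"
  assumes "(f has_sum a) A" "(g has_sum b) A"
  shows "((\<lambda>x. f x - g x) has_sum (a - b)) A"
  using has_sum_add[OF assms(1), of "\<lambda>x. - g x" "- b"] assms(2) by (simp add: has_sum_uminus)

section \<open>The Catalan series\<close>

text \<open>
  Catalan numbers are, up to sign and scale, the coefficients of \<open>\<surd>(1-4x)\<close>. Both sides satisfy the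
  recurrence \<open>(n+2) c\<^sub>n\<^sub>+\<^sub>1 = (4n+2) c\<^sub>n\<close>; the division in the definition of \<open>catalan\<close> is exact because
  the quotient is a difference of two binomial coefficients.
\<close>

lemma catalan_eq_gbinomial:
  "of_nat (catalan n) = - (((1/2 :: rat) gchoose Suc n) * (-4) ^ Suc n) / 2"
proof -
  have rec: "of_nat ((2 * n) choose n) = of_nat (Suc n) * (- (((1/2 :: rat) gchoose Suc n) * (-4) ^ Suc n) / 2)"
  proof (induction n)
    case 0
    then show ?case by simp
  next
    case (Suc n)
    define c :: rat where "c = of_nat ((2 * n) choose n)"
    define d :: rat where "d = of_nat ((2 * Suc n) choose Suc n)"
    have 1: "of_nat (Suc n) * of_nat (Suc n) * d = (2 * of_nat n + 2) * (2 * of_nat n + 1) * c"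
    proof -
      have two: "2 * Suc n = Suc (Suc (2 * n))" by simp
      have "Suc n * Suc n * ((2 * Suc n) choose Suc n) = Suc n * (Suc (Suc (2 * n)) * (Suc (2 * n) choose n))"
        unfolding two mult.assoc by (simp only: Suc_times_binomial)
      also have "\<dots> = (2 * n + 2) * (Suc n * (Suc (2 * n) choose n))"
        by (simp add: algebra_simps del: binomial_Suc_Suc)
      also have "Suc n * (Suc (2 * n) choose n) = (2 * n + 1) * ((2 * n) choose n)"
        using binomial_absorb_comp[of "Suc (2 * n)" n] by simp
      finally have "Suc n * Suc n * ((2 * Suc n) choose Suc n) = (2 * n + 2) * (2 * n + 1) * ((2 * n) choose n)"
        by (simp only: mult.assoc)
      then have "(of_nat (Suc n * Suc n * ((2 * Suc n) choose Suc n)) :: rat) =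
          of_nat ((2 * n + 2) * (2 * n + 1) * ((2 * n) choose n))"
        by (rule arg_cong)
      then show ?thesis unfolding c_def d_def by (simp only: of_nat_mult of_nat_add of_nat_1 of_nat_numeral)
    qed
    have 2: "of_nat (Suc (Suc n)) * ((1/2 :: rat) gchoose Suc (Suc n)) = (1/2 - of_nat (Suc n)) * ((1/2) gchoose Suc n)"
      using gbinomial_mult_1[of "1/2::rat" "Suc n"]
      by (simp add: algebra_simps)
    define g :: rat where "g = (1/2) gchoose Suc n"
    define h :: rat where "h = (1/2) gchoose Suc (Suc n)"
    have c: "c = of_nat (Suc n) * (- (g * (-4) ^ Suc n) / 2)"
      using Suc.IH by (simp only: c_def g_def)
    have "of_nat (Suc n) * d = 2 * (2 * of_nat n + 1) * c"
    proof -
      have "of_nat (Suc n) * (of_nat (Suc n) * d) = of_nat (Suc n) * (2 * (2 * of_nat n + 1) * c)"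
        using 1 by (simp add: algebra_simps)
      then show ?thesis by (simp only: mult_cancel_left of_nat_eq_0_iff) simp
    qed
    also have "\<dots> = of_nat (Suc n) * (4 * of_nat n + 2) * (- (g * (-4) ^ Suc n) / 2)"
      unfolding c by (simp add: algebra_simps)
    finally have "d = (4 * of_nat n + 2) * (- (g * (-4) ^ Suc n) / 2)"
      by (simp only: mult.assoc mult_cancel_left of_nat_eq_0_iff) simp
    also have "\<dots> = - (((1/2 - of_nat (Suc n)) * g) * (-4) ^ Suc (Suc n)) / 2"
      by (simp add: field_simps)
    also have "(1/2 - of_nat (Suc n)) * g = of_nat (Suc (Suc n)) * h"
      using 2 by (simp only: g_def h_def)
    finally show ?case unfolding d_def h_def by (simp only: mult.assoc)
  qed
  have "Suc n * ((2 * n) choose Suc n) = n * ((2 * n) choose n)"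
    using binomial_absorption[of n "2 * n"] binomial_absorb_comp[of "2 * n" n] by auto
  then have "Suc n * (((2 * n) choose n) - ((2 * n) choose Suc n)) = (2 * n) choose n"
    by (simp add: algebra_simps)
  then have "Suc n * catalan n = (2 * n) choose n"
    unfolding catalan_def by (metis Suc_eq_plus1 dvd_mult_div_cancel dvd_triv_left)
  then have "of_nat (Suc n) * of_nat (catalan n) = of_nat (Suc n) * (- (((1/2 :: rat) gchoose Suc n) * (-4) ^ Suc n) / 2)"
    using rec by (simp only: of_nat_mult[symmetric])
  then show ?thesis by (simp only: mult_cancel_left of_nat_eq_0_iff) simp
qed

text \<open>
  Squaring \<open>1 - 2xC = \<surd>(1-4x)\<close>.
\<close>

lemma catalan_fps: 
  fixes F :: "rat fps"
  defines "F \<equiv> Abs_fps (\<lambda>n. of_nat (catalan n))"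
  shows "F = 1 + fps_X * F ^ 2"
proof -
  have S: "fps_compose (fps_binomial (1/2)) (fps_const (-4) * fps_X) = 1 - fps_const 2 * fps_X * F"
  proof (rule fps_ext)
    fix n
    show "fps_compose (fps_binomial (1/2)) (fps_const (-4) * fps_X) $ n = (1 - fps_const 2 * fps_X * F) $ n"
      by (cases n) (simp_all add: F_def fps_compose_linear catalan_eq_gbinomial mult.assoc)
  qed
  have "(fps_compose (fps_binomial (1/2)) (fps_const (-4 :: rat) * fps_X)) ^ 2 
      = fps_compose (1 + fps_X) (fps_const (-4) * fps_X)"
    by (subst fps_compose_power) (simp_all add: fps_binomial_power fps_binomial_1)
  also have "\<dots> = 1 - fps_const 4 * fps_X"
    by (simp add: fps_compose_add_distrib fps_const_neg[symmetric] del: fps_const_neg)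
  finally have "(1 - fps_const 2 * fps_X * F)^2 = 1 - fps_const 4 * fps_X"
    by (simp add: S)
  then have "fps_const 4 * fps_X * F = fps_const 4 * fps_X * (1 + fps_X * F^2)"
    by (simp add: power2_eq_square algebra_simps fps_const_mult[symmetric] numeral_fps_const)
  then show ?thesis by simp
qed

text \<open>
  The quadratic equation is turned into an identity of natural numbers, which can then be read in a
  field of any characteristic.
\<close>

lemma catalan_convolution: "catalan (Suc n) = (\<Sum>k\<le>n. catalan k * catalan (n - k))"
proof -
  have sq: "((Abs_fps (\<lambda>n. of_nat (catalan n))) ^ 2) $ n = (of_nat (\<Sum>k\<le>n. catalan k * catalan (n - k)) :: rat)"
    by (simp add: power2_eq_square fps_mult_nth atLeast0AtMost)
  have "(of_nat (catalan (Suc n)) :: rat) = (1 + fps_X * (Abs_fps (\<lambda>n. of_nat (catalan n))) ^ 2) $ Suc n"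
    by (subst catalan_fps[symmetric]) simp
  also have "\<dots> = of_nat (\<Sum>k\<le>n. catalan k * catalan (n - k))"
    using sq by simp
  finally show ?thesis by (simp only: of_nat_eq_iff)
qed

lemma C_ser_eq: "(C_ser :: 'a::field fls) = 1 + x_ser * C_ser ^ 2"
proof -
  define F :: "'a fps" where "F = Abs_fps (\<lambda>n. of_nat (catalan n))"
  have "F = 1 + fps_X * F ^ 2"
  proof (rule fps_ext)
    fix n show "F $ n = (1 + fps_X * F ^ 2) $ n"
    proof (cases n)
      case 0
      then show ?thesis by (simp add: F_def catalan_def)
    next
      case (Suc m)
      have "F $ n = of_nat (\<Sum>k\<le>m. catalan k * catalan (m - k))"
        by (simp add: F_def Suc catalan_convolution)
      also have "\<dots> = (F ^ 2) $ m"
        by (simp add: F_def power2_eq_square fps_mult_nth atLeast0AtMost)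
      also have "\<dots> = (1 + fps_X * F ^ 2) $ n"
        by (simp add: Suc)
      finally show ?thesis .
    qed
  qed
  then have "fps_to_fls F = fps_to_fls (1 + fps_X * F ^ 2)" by simp
  then have "fps_to_fls F = 1 + fls_X * fps_to_fls F ^ 2"
    by (simp add: fls_times_fps_to_fls fps_to_fls_power)
  then have "fls_compose_power (fps_to_fls F) 2 = fls_compose_power (1 + fls_X * fps_to_fls F ^ 2) 2"
    by simp
  then show ?thesis
    by (simp add: C_ser_def F_def x_ser_def sqrt_x_def fls_X_power_conv_shift_1)
qed

lemma C_ser_integral [simp]: "ord_ge 0 (C_ser :: 'a::field fls)"
  by (simp add: C_ser_def ord_ge_def fls_nth_compose_power)

section \<open>Words and the removal of zeros\<close>

text \<open>
  The conditions on \<open>words_L\<close> without positions: \<open>takeWhile\<close> and \<open>dropWhile\<close> cut the word just before the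
  first occurrence of \<open>Suc k\<close>. The second piece starts with \<open>Suc k\<close>, which differs from \<open>k\<close>, so the two
  memberships say that \<open>k\<close> occurs strictly before and strictly after that position.
\<close>

definition L_word :: "nat list \<Rightarrow> bool" where
  "L_word a \<longleftrightarrow> successively (\<lambda>x y. x \<le> y + 1) a \<and>
     (\<forall>k. Suc k \<in> set a \<longrightarrow> k \<in> set (takeWhile (\<lambda>y. y \<noteq> Suc k) a) \<and> k \<in> set (dropWhile (\<lambda>y. y \<noteq> Suc k) a))"

lemma takeWhile_first_occurrence:
  assumes "i < length a" "\<forall>j<i. a ! j \<noteq> a ! i"
  shows "takeWhile (\<lambda>y. y \<noteq> a ! i) a = take i a" "dropWhile (\<lambda>y. y \<noteq> a ! i) a = drop i a"
proof -
  show take: "takeWhile (\<lambda>y. y \<noteq> a ! i) a = take i a"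
    by (rule takeWhile_eq_take_P_nth) (use assms in auto)
  show "dropWhile (\<lambda>y. y \<noteq> a ! i) a = drop i a"
    using assms(1) by (simp add: dropWhile_eq_drop take)
qed

lemma words_L_iff_L_word: "a \<in> words_L n \<longleftrightarrow> length a = n \<and> L_word a"
proof (cases "length a = n")
  case n: True
  have A: "(\<forall>i. Suc i < n \<longrightarrow> a ! i \<le> a ! Suc i + 1) \<longleftrightarrow> successively (\<lambda>x y. x \<le> y + 1) a"
    by (simp add: successively_conv_nth n)
  have B: "(\<exists>i1 i2. i1 < i \<and> i < i2 \<and> i2 < n \<and> a ! i1 = a ! i - 1 \<and> a ! i2 = a ! i - 1) \<longleftrightarrow>
      k \<in> set (takeWhile (\<lambda>y. y \<noteq> Suc k) a) \<and> k \<in> set (dropWhile (\<lambda>y. y \<noteq> Suc k) a)"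
    if i: "i < n" "\<forall>j<i. a ! j \<noteq> a ! i" "a ! i = Suc k" for i k
  proof -
    have tk: "k \<in> set (take i a) \<longleftrightarrow> (\<exists>i1<i. a ! i1 = k)"
      using i n by (auto simp: in_set_conv_nth)
    have "k \<in> set (drop i a) \<longleftrightarrow> (\<exists>m. i + m < n \<and> a ! (i + m) = k)"
      unfolding in_set_conv_nth using i n by (auto simp: less_diff_conv add.commute)
    also have "\<dots> \<longleftrightarrow> (\<exists>i2. i < i2 \<and> i2 < n \<and> a ! i2 = k)"
    proof
      assume "\<exists>m. i + m < n \<and> a ! (i + m) = k"
      then obtain m where m: "i + m < n" "a ! (i + m) = k" by blast
      moreover have "m \<noteq> 0" using m i by (intro notI) simp
      ultimately show "\<exists>i2. i < i2 \<and> i2 < n \<and> a ! i2 = k" by (intro exI[of _ "i + m"]) auto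
    next
      assume "\<exists>i2. i < i2 \<and> i2 < n \<and> a ! i2 = k"
      then obtain i2 where "i < i2" "i2 < n" "a ! i2 = k" by blast
      then show "\<exists>m. i + m < n \<and> a ! (i + m) = k" by (intro exI[of _ "i2 - i"]) auto
    qed
    finally show ?thesis
      using takeWhile_first_occurrence[of i a] i n tk by auto
  qed
  have ex: "\<exists>i<n. a ! i = k \<and> (\<forall>j<i. a ! j \<noteq> a ! i)" if "k \<in> set a" for k
  proof -
    from that obtain i where "i < n \<and> a ! i = k" using n by (auto simp: in_set_conv_nth)
    then have "\<exists>i. (i < n \<and> a ! i = k) \<and> (\<forall>j<i. \<not> (j < n \<and> a ! j = k))"
      using exists_least_iff[of "\<lambda>i. i < n \<and> a ! i = k"] by blast
    then show ?thesis by (metis less_trans)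
  qed
  have "(\<forall>i<n. a ! i > 0 \<and> (\<forall>j<i. a ! j \<noteq> a ! i) \<longrightarrow>
        (\<exists>i1 i2. i1 < i \<and> i < i2 \<and> i2 < n \<and> a ! i1 = a ! i - 1 \<and> a ! i2 = a ! i - 1)) \<longleftrightarrow>
      (\<forall>k. Suc k \<in> set a \<longrightarrow> k \<in> set (takeWhile (\<lambda>y. y \<noteq> Suc k) a) \<and> k \<in> set (dropWhile (\<lambda>y. y \<noteq> Suc k) a))"
    (is "?L \<longleftrightarrow> ?R")
  proof
    assume L: ?L
    show ?R
    proof (intro allI impI)
      fix k assume "Suc k \<in> set a"
      from ex[OF this] obtain i where i: "i < n" "\<forall>j<i. a ! j \<noteq> a ! i" "a ! i = Suc k" by blast
      moreover have "a ! i > 0" using i by simp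
      ultimately show "k \<in> set (takeWhile (\<lambda>y. y \<noteq> Suc k) a) \<and> k \<in> set (dropWhile (\<lambda>y. y \<noteq> Suc k) a)"
        using L B[OF i] by blast
    qed
  next
    assume R: ?R
    show ?L
    proof (intro allI impI)
      fix i assume i: "i < n" "a ! i > 0 \<and> (\<forall>j<i. a ! j \<noteq> a ! i)"
      then obtain k where k: "a ! i = Suc k" using gr0_implies_Suc by blast
      then have "Suc k \<in> set a" using i n by (metis nth_mem)
      then show "\<exists>i1 i2. i1 < i \<and> i < i2 \<and> i2 < n \<and> a ! i1 = a ! i - 1 \<and> a ! i2 = a ! i - 1"
        using R B[of i k] i k by blast
    qed
  qed
  then show ?thesis using n A by (simp add: words_L_def L_word_def)
qed (auto simp: words_L_def)

definition peel :: "nat list \<Rightarrow> nat list" where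
  "peel a = map (\<lambda>x. x - 1) (filter (\<lambda>x. x \<noteq> 0) a)"

lemma peel_Nil [simp]: "peel [] = []" 
  by (simp add: peel_def)

lemma peel_Cons [simp]: "peel (x # a) = (case x of 0 \<Rightarrow> peel a | Suc y \<Rightarrow> y # peel a)"
  by (simp add: peel_def split: nat.split)

lemma in_set_peel_iff: "k \<in> set (peel a) \<longleftrightarrow> Suc k \<in> set a"
  by (induction a) (auto split: nat.split)

lemma count_list_peel: "count_list (peel a) k = count_list a (Suc k)"
  by (induction a) (auto split: nat.split)

lemma length_peel: "length (peel a) + count_list a 0 = length a"
  by (induction a) (auto split: nat.split)

lemma takeWhile_peel: "takeWhile (\<lambda>y. y \<noteq> k) (peel a) = peel (takeWhile (\<lambda>y. y \<noteq> Suc k) a)"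
  by (induction a) (auto split: nat.split)

lemma dropWhile_peel: "dropWhile (\<lambda>y. y \<noteq> k) (peel a) = peel (dropWhile (\<lambda>y. y \<noteq> Suc k) a)"
  by (induction a) (auto split: nat.split)

text \<open>
  The condition on consecutive letters splits into one on the peeled word and one on the places of the
  zeros: a zero may follow only a \<open>0\<close> or a \<open>1\<close>. Inserting zeros after a \<open>1\<close> is harmless for the peeled
  word, where that letter is a \<open>0\<close>, and a \<open>0\<close> may be followed by anything.
\<close>

lemma successively_peel_iff:
  "successively (\<lambda>x y. x \<le> y + 1) a \<longleftrightarrow>
     successively (\<lambda>x y. y = 0 \<longrightarrow> x \<le> 1) a \<and> successively (\<lambda>x y. x \<le> y + 1) (peel a)"
proof (induction a)
  case (Cons x a)
  show ?case
  proof (cases a)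
    case (Cons y a')
    then show ?thesis
      using Cons.IH
      by (cases x; cases y; cases "peel a'") (auto simp: successively_Cons)
  qed (auto split: nat.split)
qed auto

text \<open>
  Insertion of zeros is encoded as the inverse of peeling, so that all words above \<open>b\<close> are fillings of \<open>b\<close>;
  by \<open>successively_peel_iff\<close>, the second condition is the part of the condition on consecutive letters that
  peeling does not see.
\<close>

definition zero_fillings :: "nat list \<Rightarrow> nat list set" where
  "zero_fillings b = {a. peel a = b \<and> successively (\<lambda>x y. y = 0 \<longrightarrow> x \<le> 1) a}"

text \<open>
  The first letter of a filling is an inserted zero or the raised first letter of \<open>b\<close>; in the latter case
  a zero may come next only if the raised letter is \<open>1\<close>. This gives the three recursions below, which determine
  the generating function of the fillings of \<open>b\<close>.
\<close>

lemma zero_fillings_ConsE: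
  assumes "a \<in> zero_fillings b" 
  obtains "a = []" "b = []" | a' where "a = 0 # a'" "a' \<in> zero_fillings b"
    | k a' b' where "a = Suc k # a'" "b = k # b'" "a' \<in> zero_fillings b'" "k > 0 \<longrightarrow> a' \<notin> (#) 0 ` zero_fillings b'"
proof (cases a)
  case Nil
  then show ?thesis using assms that(1) by (simp add: zero_fillings_def)
next
  case (Cons x a')
  show ?thesis
  proof (cases x)
    case 0
    then show ?thesis
      using assms Cons that(2)[of a'] by (cases a') (auto simp: zero_fillings_def)
  next
    case (Suc k)
    have a': "a' \<in> zero_fillings (peel a')" "b = k # peel a'" "a' \<noteq> [] \<longrightarrow> hd a' = 0 \<longrightarrow> k = 0"
      using assms Cons Suc by (auto simp: zero_fillings_def successively_Cons)
    then have "k > 0 \<longrightarrow> a' \<notin> (#) 0 ` zero_fillings (peel a')" by auto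
    with a' Cons Suc show ?thesis using that(3)[of k a' "peel a'"] by simp
  qed
qed

lemma Cons_0_zero_fillings_iff: "0 # a \<in> zero_fillings b \<longleftrightarrow> a \<in> zero_fillings b"
  unfolding zero_fillings_def by (cases a) auto

lemma zero_fillings_Nil: "zero_fillings [] = insert [] ((#) 0 ` zero_fillings [])"
  by (auto simp: Cons_0_zero_fillings_iff elim: zero_fillings_ConsE) (simp add: zero_fillings_def)

lemma zero_fillings_0_Cons:
  "zero_fillings (0 # b) = (#) 1 ` zero_fillings b \<union> (#) 0 ` zero_fillings (0 # b)"
proof -
  have "1 # a \<in> zero_fillings (0 # b)" if "a \<in> zero_fillings b" for a
    using that unfolding zero_fillings_def by (cases a) auto
  then show ?thesis
    by (auto simp: Cons_0_zero_fillings_iff elim: zero_fillings_ConsE)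
qed

lemma zero_fillings_Suc_Cons:
  "zero_fillings (Suc k # b) =
     (#) (Suc (Suc k)) ` (zero_fillings b - (#) 0 ` zero_fillings b) \<union> (#) 0 ` zero_fillings (Suc k # b)"
proof -
  have "Suc (Suc k) # a \<in> zero_fillings (Suc k # b)"
    if "a \<in> zero_fillings b" "a \<notin> (#) 0 ` zero_fillings b" for a
  proof -
    have "a \<noteq> [] \<longrightarrow> hd a \<noteq> 0"
      using \<open>a \<in> zero_fillings b\<close> \<open>a \<notin> (#) 0 ` zero_fillings b\<close>
      by (cases a) (auto simp: Cons_0_zero_fillings_iff)
    then show ?thesis using that(1) by (auto simp: zero_fillings_def successively_Cons)
  qed
  then show ?thesis
    by (auto simp: Cons_0_zero_fillings_iff elim: zero_fillings_ConsE)
qed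

lemma length_zero_fillings: "a \<in> zero_fillings b \<Longrightarrow> length a = length b + count_list a 0"
  using length_peel[of a] by (auto simp: zero_fillings_def)

lemma finite_zero_fillings: "finite {a \<in> zero_fillings b. count_list a 0 \<le> N}"
proof (rule finite_subset)
  show "{a \<in> zero_fillings b. count_list a 0 \<le> N} \<subseteq>
      {a. set a \<subseteq> insert 0 (Suc ` set b) \<and> length a \<le> length b + N}"
  proof safe
    fix a x assume "a \<in> zero_fillings b" "x \<in> set a" "x \<notin> Suc ` set b"
    then show "x = 0" using in_set_peel_iff[of "x - 1" a] by (cases x) (auto simp: zero_fillings_def)
  qed (auto dest: length_zero_fillings)
  show "finite {a. set a \<subseteq> insert 0 (Suc ` set b) \<and> length a \<le> length b + N}"
    by (rule finite_lists_length_le) auto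
qed

lemma L_word_hd:
  assumes "L_word a" "a \<noteq> []"
  shows "hd a = 0"
proof (rule ccontr)
  assume "hd a \<noteq> 0"
  then obtain k where k: "hd a = Suc k" using not0_implies_Suc by blast
  then have "Suc k \<in> set a" using assms(2) by (metis hd_in_set)
  then have "k \<in> set (takeWhile (\<lambda>y. y \<noteq> Suc k) a)" using assms(1) by (simp add: L_word_def)
  then show False using k assms(2) by (cases a) auto
qed

text \<open>
  For \<open>c = map Suc b\<close> these are the fillings of \<open>b\<close> that insert zeros at the front only.
\<close>

definition zeros_then :: "nat list \<Rightarrow> nat list set" where
  "zeros_then c = range (\<lambda>j. replicate j 0 @ c)"

text \<open>
  The condition on the first occurrence of a letter \<open>k \<ge> 2\<close> passes to the letter \<open>k - 1\<close> of the peeled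
  word. What remains is the condition on the first \<open>1\<close>, which is the first nonzero letter since a word
  starts with \<open>0\<close>: there is a zero before it, that is, the word starts with a zero, and there is a zero
  after it, that is, not all inserted zeros are at the front.
\<close>

lemma L_word_peel_iff:
  assumes "b \<noteq> []"
  shows "L_word a \<and> peel a = b \<longleftrightarrow>
     L_word b \<and> a \<in> (#) 0 ` (zero_fillings b - zeros_then (map Suc b))"
    (is "?L \<longleftrightarrow> ?R")
proof -
  have step: "k \<in> set (takeWhile (\<lambda>y. y \<noteq> Suc k) (peel a)) \<longleftrightarrow> Suc k \<in> set (takeWhile (\<lambda>y. y \<noteq> Suc (Suc k)) a)"
       "k \<in> set (dropWhile (\<lambda>y. y \<noteq> Suc k) (peel a)) \<longleftrightarrow> Suc k \<in> set (dropWhile (\<lambda>y. y \<noteq> Suc (Suc k)) a)" for k a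
    by (simp_all add: takeWhile_peel dropWhile_peel in_set_peel_iff)
  have all_nat_split: "(\<forall>k. P k) \<longleftrightarrow> P 0 \<and> (\<forall>k. P (Suc k))" for P :: "nat \<Rightarrow> bool"
    by (metis not0_implies_Suc)
  have main: "L_word a \<longleftrightarrow> successively (\<lambda>x y. y = 0 \<longrightarrow> x \<le> 1) a \<and> L_word (peel a) \<and>
      (1 \<in> set a \<longrightarrow> 0 \<in> set (takeWhile (\<lambda>y. y \<noteq> 1) a) \<and> 0 \<in> set (dropWhile (\<lambda>y. y \<noteq> 1) a))"
    unfolding L_word_def successively_peel_iff[of a] step in_set_peel_iff
    by (subst all_nat_split) auto
  show ?thesis
  proof (cases "L_word b \<and> a \<in> zero_fillings b")
    case True
    then have b: "L_word b" and a: "peel a = b" "successively (\<lambda>x y. y = 0 \<longrightarrow> x \<le> 1) a"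
      by (auto simp: zero_fillings_def)
    obtain b' where b': "b = 0 # b'" using L_word_hd[OF b] assms by (cases b) auto
    \<comment> \<open>The word splits at its first nonzero letter, which is a \<open>1\<close>.\<close>
    define z where "z = takeWhile (\<lambda>y. y = 0) a"
    define r where "r = dropWhile (\<lambda>y. y = 0) a"
    have z: "set z \<subseteq> {0}" by (auto simp: z_def dest: set_takeWhileD)
    have az: "a = z @ r" by (simp add: z_def r_def)
    have zrep: "z = replicate (length z) 0"
      using z by (intro replicate_eqI) auto
    have pz: "peel (replicate n 0 @ c) = peel c" for n c by (induction n) auto
    have pr: "peel r = b" using a(1) az zrep pz by metis
    have "r \<noteq> []" using pr assms by auto
    then have "hd r \<noteq> 0" unfolding r_def by (rule hd_dropWhile)
    then obtain r' where r': "r = 1 # r'" 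
      using pr b' by (cases r) (auto split: nat.splits)
    have T: "takeWhile (\<lambda>y. y \<noteq> 1) a = z" "dropWhile (\<lambda>y. y \<noteq> 1) a = r" "1 \<in> set a"
      using az r' z by (auto simp: takeWhile_append dropWhile_append)
    have "a \<in> zeros_then (map Suc b) \<longleftrightarrow> r = map Suc b"
    proof
      assume "a \<in> zeros_then (map Suc b)"
      then obtain j where j: "a = replicate j 0 @ map Suc b" by (auto simp: zeros_then_def)
      have "dropWhile (\<lambda>y. y = 0) (replicate j (0::nat) @ map Suc b) = map Suc b"
        using b' by (induction j) auto
      then show "r = map Suc b" using j by (simp add: r_def)
    next
      assume "r = map Suc b"
      then show "a \<in> zeros_then (map Suc b)" using az zrep by (auto simp: zeros_then_def)
    qed
    moreover have "r = map Suc b \<longleftrightarrow> 0 \<notin> set r"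
    proof -
      have "0 \<notin> set c \<Longrightarrow> map Suc (peel c) = c" for c
        by (induction c) (auto split: nat.splits)
      then show ?thesis using pr by (metis nat.distinct(1) imageE list.set_map)
    qed
    ultimately have Z: "a \<notin> zeros_then (map Suc b) \<longleftrightarrow> 0 \<in> set r" by blast
    have "a \<in> (#) 0 ` (zero_fillings b - zeros_then (map Suc b)) \<longleftrightarrow> z \<noteq> [] \<and> a \<notin> zeros_then (map Suc b)"
    proof (cases z)
      case Nil
      then show ?thesis using az r' by auto
    next
      case (Cons y z')
      then have y: "a = 0 # z' @ r" using az z by auto
      have "0 # c \<in> zeros_then (map Suc b) \<longleftrightarrow> c \<in> zeros_then (map Suc b)" for c
      proof
        assume "0 # c \<in> zeros_then (map Suc b)"
        then obtain j where j: "0 # c = replicate j 0 @ map Suc b" by (auto simp: zeros_then_def)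
        then obtain j' where "j = Suc j'" using b' by (cases j) auto
        then show "c \<in> zeros_then (map Suc b)" using j by (auto simp: zeros_then_def)
      next
        assume "c \<in> zeros_then (map Suc b)"
        then obtain j where "c = replicate j 0 @ map Suc b" by (auto simp: zeros_then_def)
        then have "0 # c = replicate (Suc j) 0 @ map Suc b" by simp
        then show "0 # c \<in> zeros_then (map Suc b)" unfolding zeros_then_def by (metis rangeI)
      qed
      then show ?thesis using True y Cons by (auto simp: Cons_0_zero_fillings_iff)
    qed
    moreover have "0 \<in> set z \<longleftrightarrow> z \<noteq> []" using z by (cases z) auto
    ultimately show ?thesis using main[of] T Z a b by simp
  next
    case False
    have "\<not> ?L" using False main by (auto simp: zero_fillings_def)
    moreover have "\<not> ?R" using False by (auto simp: Cons_0_zero_fillings_iff)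
    ultimately show ?thesis by blast
  qed
qed

lemma L_word_peel_Nil_iff:
  "L_word a \<and> a \<noteq> [] \<and> peel a = [] \<longleftrightarrow> a \<in> (#) 0 ` zero_fillings []"
proof -
  have eq: "peel a = [] \<longleftrightarrow> set a \<subseteq> {0}" for a by (induction a) (auto split: nat.split)
  have "L_word a" if "set a \<subseteq> {0}" for a
  proof -
    have "successively (\<lambda>x y. x \<le> y + 1) a" using that by (induction a) (auto simp: successively_Cons)
    moreover have "Suc k \<notin> set a" for k using that by auto
    ultimately show ?thesis by (simp add: L_word_def)
  qed
  moreover have "a \<in> zero_fillings [] \<longleftrightarrow> set a \<subseteq> {0}" for a
  proof -
    have "set a \<subseteq> {0} \<Longrightarrow> successively (\<lambda>x y. y = 0 \<longrightarrow> x \<le> 1) a"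
      by (induction a) (auto simp: successively_Cons)
    then show ?thesis by (auto simp: zero_fillings_def eq)
  qed
  ultimately show ?thesis unfolding eq by (cases a) auto
qed

lemma L_word_peel: "L_word a \<Longrightarrow> L_word (peel a)"
  using L_word_peel_iff[of "peel a" a] by (cases "peel a = []") (auto simp: L_word_def)

lemma count_list_ge_2:
  assumes "k \<in> set (takeWhile P a)" "k \<in> set (dropWhile P a)"
  shows "2 \<le> count_list a k"
proof -
  have "count_list a k = count_list (takeWhile P a) k + count_list (dropWhile P a) k"
    by (metis count_list_append takeWhile_dropWhile_id)
  moreover have "count_list (takeWhile P a) k \<noteq> 0" "count_list (dropWhile P a) k \<noteq> 0"
    using assms by (simp_all add: count_list_0_iff)
  ultimately show ?thesis by linarith
qed

lemma smaller_letters_in_L_word: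
  assumes "L_word a" "k \<in> set a" "j \<le> k"
  shows "j \<in> set a"
  using assms(2,3)
proof (induction k)
  case (Suc k)
  have "k \<in> set a" using assms(1) Suc.prems(1) by (auto simp: L_word_def dest: set_takeWhileD)
  then show ?case using Suc by (cases "j = Suc k") auto
qed simp

text \<open>
  Each of the letters \<open>1, \<dots>, k\<close> occurs at least twice, before and after the first occurrence of its
  successor. This shows that \<open>A4_index\<close> omits no word containing the marked letter, and that a word of
  length \<open>n\<close> has letters at most \<open>n\<close>.
\<close>

lemma L_word_length_bound:
  assumes "L_word a" "Suc k \<in> set a"
  shows "count_list a (Suc k) + count_list a 0 + 2 * k \<le> length a"
  using assms
proof (induction k arbitrary: a)
  case 0
  have "count_list (peel a) 0 \<le> length (peel a)" by (rule count_le_length)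
  then show ?case using length_peel[of a] by (simp add: count_list_peel)
next
  case (Suc k)
  define b where "b = peel a"
  have b: "L_word b" "Suc k \<in> set b"
    using Suc.prems by (auto simp: b_def L_word_peel in_set_peel_iff)
  have "1 \<in> set b" using smaller_letters_in_L_word[OF b] by simp
  then have "2 \<le> count_list b 0"
    using b(1) by (intro count_list_ge_2[where P = "\<lambda>y. y \<noteq> Suc 0"]) (auto simp: L_word_def)
  moreover have "count_list b (Suc k) + count_list b 0 + 2 * k \<le> length b"
    using Suc.IH[OF b] .
  ultimately show ?case using length_peel[of a] by (simp add: b_def count_list_peel)
qed

section \<open>Generating functions of words\<close>

lemma has_sum_zero_Cons:
  fixes z :: "'a::field fls"
  assumes "((\<lambda>a. z ^ count_list a 0) has_sum s) Z"
  shows "((\<lambda>a. z ^ count_list a 0) has_sum z * s) ((#) (0::nat) ` Z)"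
  using has_sum_cmult_right[OF assms, of z] by (subst has_sum_reindex) (auto simp: o_def)

text \<open>
  A geometric series in disguise: a set of words that consists of \<open>Y\<close> and of its own members with a zero
  put in front has the generating function of \<open>Y\<close> divided by \<open>1 - z\<close>.
\<close>

lemma has_sum_zero_closed:
  fixes z :: "'a::field fls"
  assumes Z: "Z = Y \<union> (#) (0::nat) ` Z" and disj: "Y \<inter> (#) 0 ` Z = {}"
    and Y: "((\<lambda>a. z ^ count_list a 0) has_sum s) Y"
    and summable: "(\<lambda>a. z ^ count_list a 0) summable_on Z" and z: "ord_ge 1 z"
  shows "((\<lambda>a. z ^ count_list a 0) has_sum 1 / (1 - z) * s) Z"
proof -
  obtain S where S: "((\<lambda>a. z ^ count_list a 0) has_sum S) Z"
    using summable by (auto simp: summable_on_def)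
  have "((\<lambda>a. z ^ count_list a 0) has_sum (s + z * S)) Z"
    using has_sum_Un_disjoint[OF Y has_sum_zero_Cons[OF S] disj] Z by simp
  then have "S = s + z * S" using S has_sum_unique by blast
  then have "S * (1 - z) = s" by (simp add: algebra_simps)
  then have "S = 1 / (1 - z) * s" using one_minus_unit(1)[OF z] by (simp add: field_simps)
  with S show ?thesis by simp
qed

lemma ord_ge_power_self:
  fixes z :: "'a::field fls"
  assumes "ord_ge 1 z" shows "ord_ge (int n) (z ^ n)"
proof (induction n)
  case (Suc n)
  then show ?case using ord_ge_mult[OF assms, of "int n" "z ^ n"] by (simp add: add.commute)
qed simp

lemma zero_fillings_summable:
  fixes z :: "'a::field fls"
  assumes z: "ord_ge 1 z" and sub: "Z \<subseteq> zero_fillings b"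
  shows "(\<lambda>a. z ^ count_list a 0) summable_on Z"
proof (rule fls_summable_onI)
  show "ord_ge 0 (z ^ count_list a 0)" for a :: "nat list"
    by (rule ord_ge_power, rule ord_ge_mono[OF z]) simp
  fix N
  have "m \<le> N" if "\<not> ord_ge (int N) (z ^ m)" for m
  proof (rule ccontr)
    assume "\<not> m \<le> N"
    then have "ord_ge (int N) (z ^ m)" by (intro ord_ge_mono[OF ord_ge_power_self[OF z]]) simp
    with that show False by contradiction
  qed
  then show "finite {a \<in> Z. \<not> ord_ge (int N) (z ^ count_list a 0)}"
    using sub by (intro finite_subset[OF _ finite_zero_fillings[of b N]]) blast
qed

text \<open>
  Zeros can be inserted independently at the front and after each \<open>0\<close> of \<open>b\<close>, and each place contributes
  a geometric series.
\<close>

lemma zero_fillings_has_sum: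
  fixes z :: "'a::field fls"
  assumes z: "ord_ge 1 z"
  shows "((\<lambda>a. z ^ count_list a 0) has_sum (1 / (1 - z)) ^ Suc (count_list b 0)) (zero_fillings b)"
proof (induction b)
  case Nil
  have Y: "((\<lambda>a. z ^ count_list a 0) has_sum 1) {[]::nat list}" by (intro has_sum_finiteI) auto
  have "((\<lambda>a. z ^ count_list a 0) has_sum 1 / (1 - z) * 1) (zero_fillings [])"
    by (rule has_sum_zero_closed[OF _ _ Y zero_fillings_summable[OF z order.refl] z])
      (use zero_fillings_Nil in auto)
  then show ?case by simp
next
  case (Cons k b)
  show ?case
  proof (cases k)
    case 0
    have Y: "((\<lambda>a. z ^ count_list a 0) has_sum (1 / (1 - z)) ^ Suc (count_list b 0)) ((#) 1 ` zero_fillings b)"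
      using Cons.IH by (subst has_sum_reindex) (auto simp: o_def)
    have "((\<lambda>a. z ^ count_list a 0) has_sum 1 / (1 - z) * (1 / (1 - z)) ^ Suc (count_list b 0)) (zero_fillings (0 # b))"
      by (rule has_sum_zero_closed[OF zero_fillings_0_Cons _ Y zero_fillings_summable[OF z order.refl] z]) auto
    then show ?thesis by (simp add: 0)
  next
    case (Suc m)
    have sub: "(#) 0 ` zero_fillings b \<subseteq> zero_fillings b" by (auto simp: Cons_0_zero_fillings_iff)
    define s where "s = (1 / (1 - z)) ^ Suc (count_list b 0)"
    have "((\<lambda>a. z ^ count_list a 0) has_sum (s - z * s)) (zero_fillings b - (#) 0 ` zero_fillings b)"
      using has_sum_Diff[OF Cons.IH has_sum_zero_Cons[OF Cons.IH] sub] by (simp add: s_def)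
    then have Y: "((\<lambda>a. z ^ count_list a 0) has_sum (s - z * s))
        ((#) (Suc (Suc m)) ` (zero_fillings b - (#) 0 ` zero_fillings b))"
      by (subst has_sum_reindex) (auto simp: o_def)
    have "((\<lambda>a. z ^ count_list a 0) has_sum 1 / (1 - z) * (s - z * s)) (zero_fillings (Suc m # b))"
      by (rule has_sum_zero_closed[OF zero_fillings_Suc_Cons _ Y zero_fillings_summable[OF z order.refl] z]) auto
    moreover have "1 / (1 - z) * (s - z * s) = s"
      using one_minus_unit(1)[OF z] by (simp add: field_simps)
    ultimately have "((\<lambda>a. z ^ count_list a 0) has_sum s) (zero_fillings (Suc m # b))" by simp
    then show ?thesis by (simp only: Suc s_def count_list.simps) simp
  qed
qed

lemma zeros_then_subset: "zeros_then (map Suc b) \<subseteq> zero_fillings b"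
proof -
  have "map Suc b \<in> zero_fillings b"
  proof (induction b)
    case (Cons k b)
    then show ?case by (cases b) (auto simp: zero_fillings_def)
  qed (simp add: zero_fillings_def)
  then have "replicate j 0 @ map Suc b \<in> zero_fillings b" for j
    by (induction j) (auto simp: Cons_0_zero_fillings_iff)
  then show ?thesis by (auto simp: zeros_then_def)
qed

lemma zeros_then_unfold: "zeros_then c = {c} \<union> (#) 0 ` zeros_then c"
proof (intro equalityI subsetI)
  fix a assume "a \<in> zeros_then c"
  then obtain j where j: "a = replicate j 0 @ c" by (auto simp: zeros_then_def)
  then show "a \<in> {c} \<union> (#) 0 ` zeros_then c" by (cases j) (auto simp: zeros_then_def)
next
  fix a assume "a \<in> {c} \<union> (#) 0 ` zeros_then c"
  then obtain j where "a = replicate 0 0 @ c \<or> a = replicate (Suc j) 0 @ c" by (auto simp: zeros_then_def)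
  then show "a \<in> zeros_then c" unfolding zeros_then_def by blast
qed

lemma zeros_then_has_sum:
  fixes z :: "'a::field fls"
  assumes z: "ord_ge 1 z"
  shows "((\<lambda>a. z ^ count_list a 0) has_sum 1 / (1 - z)) (zeros_then (map Suc b))"
proof -
  have count: "count_list (map Suc b) 0 = 0" by (simp add: count_list_0_iff)
  have Y: "((\<lambda>a. z ^ count_list a 0) has_sum 1) {map Suc b}"
    by (intro has_sum_finiteI) (auto simp: count)
  have "map Suc b \<notin> (#) 0 ` zeros_then (map Suc b)"
    using count by (metis count_list.simps(2) imageE nat.distinct(1) add_is_0 zero_neq_one)
  then have "((\<lambda>a. z ^ count_list a 0) has_sum 1 / (1 - z) * 1) (zeros_then (map Suc b))"
    by (intro has_sum_zero_closed[OF zeros_then_unfold _ Y zero_fillings_summable[OF z zeros_then_subset] z]) auto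
  then show ?thesis by simp
qed

definition nonempty_words :: "nat list set" where
  "nonempty_words = {a. L_word a \<and> a \<noteq> []}"

definition word_weight :: "nat \<Rightarrow> 'a::field fls \<Rightarrow> 'a fls \<Rightarrow> nat list \<Rightarrow> 'a fls" where
  "word_weight i w v a = x_ser ^ length a * w ^ count_list a 0 * v ^ count_list a i"

text \<open>
  The series \<open>F\<^sub>i(w,v)\<close>. The arguments are series rather than indeterminates, because the recursion
  substitutes \<open>L\<^sub>0(x,w)\<close> for \<open>w\<close>.
\<close>

definition letter_gf :: "nat \<Rightarrow> 'a::field fls \<Rightarrow> 'a fls \<Rightarrow> 'a fls" where
  "letter_gf i w v = infsum (word_weight i w v) nonempty_words"

lemma zero_in_word: "a \<in> nonempty_words \<Longrightarrow> 0 \<in> set a"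
  using L_word_hd[of a] by (metis (mono_tags) hd_in_set mem_Collect_eq nonempty_words_def)

lemma letter_le_length:
  assumes "a \<in> nonempty_words" "i \<in> set a"
  shows "i \<le> length a"
proof (cases i)
  case (Suc k)
  then have "Suc k \<in> set a" "count_list a (Suc k) \<noteq> 0" using assms by (auto simp: count_list_0_iff)
  then show ?thesis using L_word_length_bound[of a k] assms Suc by (simp add: nonempty_words_def)
qed simp

lemma finite_nonempty_words: "finite {a \<in> nonempty_words. length a \<le> N}"
proof (rule finite_subset)
  show "{a \<in> nonempty_words. length a \<le> N} \<subseteq> {a. set a \<subseteq> {..N} \<and> length a \<le> N}"
    using letter_le_length by fastforce
  show "finite {a. set a \<subseteq> {..N} \<and> length a \<le> N}"
    by (rule finite_lists_length_le) auto
qed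

lemma ord_ge_word_weight:
  assumes "ord_ge 0 w" "ord_ge 0 (v :: 'a::field fls)"
  shows "ord_ge (int (2 * length a)) (word_weight i w v a)"
  unfolding word_weight_def using assms by (auto intro!: ord_ge_mult_integral' ord_ge_power)

lemma word_weight_summable:
  assumes "ord_ge 0 w" "ord_ge 0 (v :: 'a::field fls)"
  shows "word_weight i w v summable_on nonempty_words"
proof (rule fls_summable_onI)
  fix N
  show "finite {a \<in> nonempty_words. \<not> ord_ge (int N) (word_weight i w v a)}"
  proof (rule finite_subset[OF _ finite_nonempty_words[of N]], safe)
    fix a assume "\<not> ord_ge (int N) (word_weight i w v a)"
    then show "length a \<le> N" using ord_ge_mono[OF ord_ge_word_weight[OF assms, of a i], of "int N"] by linarith
  qed
qed (use ord_ge_mono[OF ord_ge_word_weight[OF assms]] in auto)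

lemma letter_gf_has_sum:
  assumes "ord_ge 0 w" "ord_ge 0 (v :: 'a::field fls)"
  shows "(word_weight i w v has_sum letter_gf i w v) nonempty_words"
  unfolding letter_gf_def using word_weight_summable[OF assms] by simp

lemma ord_ge_letter_gf:
  assumes "ord_ge 0 w" "ord_ge 0 (v :: 'a::field fls)"
  shows "ord_ge 0 (letter_gf i w v)"
  by (rule has_sum_ord_ge[OF letter_gf_has_sum[OF assms]]) (use ord_ge_mono[OF ord_ge_word_weight[OF assms]] in auto)

lemma word_weight_Suc:
  "word_weight (Suc i) w v a =
     x_ser ^ length (peel a) * v ^ count_list (peel a) i * (x_ser * w) ^ count_list a 0"
  unfolding word_weight_def count_list_peel length_peel[of a, symmetric]
  by (simp add: power_add power_mult_distrib mult_ac)

text \<open>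
  The factor \<open>xw/(1-xw)\<close>: the generating function of nonempty runs of zeros.
\<close>

definition filling_gf :: "'a::field fls \<Rightarrow> 'a fls" where
  "filling_gf w = x_ser * w * L_ser 0 w"

text \<open>
  Group the words by their peeled word. The fillings of a nonempty \<open>b\<close> with \<open>r\<close> zeros weigh \<open>L\<^sup>r\<^sup>+\<^sup>1\<close>,
  from which \<open>L\<close> is subtracted for those with zeros at the front only; the summand \<open>1\<close> accounts for the
  words consisting of zeros, whose peeled word is empty.
\<close>

lemma letter_gf_Suc:
  fixes w v :: "'a::field fls"
  assumes w: "ord_ge 0 w" and v: "ord_ge 0 v"
  shows "letter_gf (Suc i) w v = filling_gf w * (1 + letter_gf i (L_ser 0 w) v - letter_gf i 1 v)"
proof -
  define z where "z = x_ser * w"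
  have z: "ord_ge 1 z" using ord_ge_x_mult[OF w] by (auto simp: z_def elim: ord_ge_mono)
  define L where "L = 1 / (1 - z)"
  have L: "L_ser 0 w = L" by (simp add: L_def z_def)
  have oL: "ord_ge 0 L" using one_minus_unit(2)[OF z] by (simp add: L_def)
  define fib where "fib = (\<lambda>b. {a \<in> nonempty_words. peel a = b})"
  define F where "F = (\<lambda>b. if b = [] then filling_gf w else filling_gf w * (word_weight i L v b - word_weight i 1 v b))"
  have g: "filling_gf w = z * L" unfolding filling_gf_def L z_def ..
  have fib: "(word_weight (Suc i) w v has_sum F b) (fib b)" if b: "b \<in> insert [] nonempty_words" for b
  proof (cases "b = []")
    case True
    have "fib b = (#) 0 ` zero_fillings []"
      using L_word_peel_Nil_iff by (auto simp: fib_def nonempty_words_def True)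
    moreover have "((\<lambda>a. z ^ count_list a 0) has_sum z * L ^ Suc (count_list [] (0::nat))) ((#) (0::nat) ` zero_fillings [])"
      unfolding L_def by (intro has_sum_zero_Cons zero_fillings_has_sum z)
    ultimately have "((\<lambda>a. z ^ count_list a 0) has_sum F b) (fib b)"
      by (simp add: F_def True g)
    then show ?thesis
      by (rule has_sum_cong[THEN iffD1, rotated]) (simp add: word_weight_Suc fib_def True z_def)
  next
    case False
    then have "fib b = (#) 0 ` (zero_fillings b - zeros_then (map Suc b))"
      using L_word_peel_iff[OF False] b by (auto simp: fib_def nonempty_words_def)
    then have "((\<lambda>a. z ^ count_list a 0) has_sum z * (L ^ Suc (count_list b 0) - L)) (fib b)"
      \<comment> \<open>The leading zero of the word accounts for the factor \<open>z\<close>.\<close>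
      using has_sum_zero_Cons[OF has_sum_Diff[OF zero_fillings_has_sum[OF z] zeros_then_has_sum[OF z] zeros_then_subset]]
      by (simp add: L_def)
    then have "((\<lambda>a. x_ser ^ length b * v ^ count_list b i * z ^ count_list a 0) has_sum
        x_ser ^ length b * v ^ count_list b i * (z * (L ^ Suc (count_list b 0) - L))) (fib b)"
      by (rule has_sum_cmult_right)
    also have "x_ser ^ length b * v ^ count_list b i * (z * (L ^ Suc (count_list b 0) - L)) = F b"
      using False by (simp add: F_def g word_weight_def algebra_simps)
    finally show ?thesis
      by (rule has_sum_cong[THEN iffD1, rotated]) (simp add: word_weight_Suc fib_def z_def)
  qed
  have "((\<lambda>p. word_weight (Suc i) w v (snd p)) has_sum letter_gf (Suc i) w v) (Sigma (insert [] nonempty_words) fib)"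
  proof (subst has_sum_reindex_bij_witness[where T = nonempty_words and j = snd
        and i = "\<lambda>a. (peel a, a)" and h = "word_weight (Suc i) w v"])
    show "(peel a, a) \<in> Sigma (insert [] nonempty_words) fib" if "a \<in> nonempty_words" for a
      using that by (auto simp: fib_def nonempty_words_def L_word_peel)
  qed (auto simp: fib_def letter_gf_has_sum[OF w v])
  then have "(F has_sum letter_gf (Suc i) w v) (insert [] nonempty_words)"
    by (rule has_sum_SigmaD) (use fib in simp)
  moreover have "(F has_sum (filling_gf w + filling_gf w * (letter_gf i L v - letter_gf i 1 v))) (insert [] nonempty_words)"
  proof -
    have "((\<lambda>b. filling_gf w * (word_weight i L v b - word_weight i 1 v b)) has_sum filling_gf w * (letter_gf i L v - letter_gf i 1 v)) nonempty_words"
      by (intro has_sum_cmult_right has_sum_diff letter_gf_has_sum oL v ord_ge_1)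
    then have "(F has_sum filling_gf w * (letter_gf i L v - letter_gf i 1 v)) nonempty_words"
      by (rule has_sum_cong[THEN iffD1, rotated]) (auto simp: F_def nonempty_words_def)
    from has_sum_insert[OF _ this, of "[]"] show ?thesis by (simp add: F_def nonempty_words_def)
  qed
  ultimately have "letter_gf (Suc i) w v = filling_gf w + filling_gf w * (letter_gf i L v - letter_gf i 1 v)"
    by (rule has_sum_unique)
  then show ?thesis unfolding L by (simp add: algebra_simps del: L_ser.simps)
qed

lemma L_ser_integral: "ord_ge 0 w \<Longrightarrow> ord_ge 0 (L_ser j w)"
  by (induction j) (auto intro: one_minus_x_unit(2))

lemma ord_ge_filling_gf: "ord_ge 0 w \<Longrightarrow> ord_ge 2 (filling_gf w)"
  unfolding filling_gf_def by (intro ord_ge_mult_integral' ord_ge_x_mult L_ser_integral)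

lemma C_ser_neq_0: "(C_ser :: 'a::field fls) \<noteq> 0"
proof
  assume "C_ser = (0 :: 'a fls)"
  then show False using C_ser_eq[where 'a = 'a] by simp
qed

text \<open>
  With \<open>L = 1/(1-xw)\<close> and \<open>C(1 - xC) = 1\<close> one finds \<open>A(x,1) = xC\<close> and \<open>A(x,L) = xC/(1-xwC)\<close>, so
  that \<open>1 + A(x,L) - A(x,1) = (1-xw)/(1-xwC)\<close>.
\<close>

lemma A2_functional:
  fixes w :: "'a::field fls"
  assumes w: "ord_ge 0 w"
  shows "A2 w = filling_gf w * (1 + A2 (L_ser 0 w) - A2 1)"
proof -
  define x :: "'a fls" where "x = x_ser"
  define C :: "'a fls" where "C = C_ser"
  have C: "C = 1 + x * C ^ 2" unfolding C_def x_def by (rule C_ser_eq)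
  have nz1: "1 - x * w \<noteq> 0" using one_minus_x_unit(1)[OF w] by (simp add: x_def)
  have nz2: "1 - x * w * C \<noteq> 0"
    using one_minus_x_unit(1)[of "w * C"] w by (simp add: x_def C_def ord_ge_mult_integral mult.assoc)
  have C0: "C \<noteq> 0" by (simp add: C_def C_ser_neq_0)
  have C1: "C * (1 - x * C) = 1" using C by (simp add: algebra_simps power2_eq_square)
  then have nz3: "1 - x * C \<noteq> 0" by auto
  have A1: "A2 1 = x * C"
  proof -
    have "x * C * (1 - x * C) = x" using C1 by (simp add: mult.assoc)
    then show ?thesis
      using nz3 by (simp add: A2_def x_def[symmetric] C_def[symmetric] nonzero_divide_eq_eq)
  qed
  have num: "(1 - x * w - x * C) * C = 1 - x * w * C"
    using C1 by (simp add: algebra_simps)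
  then have nz4: "1 - x * w - x * C \<noteq> 0" using nz2 by auto
  have "A2 (L_ser 0 w) = x / (1 - x * w - x * C)"
  proof -
    define p where "p = 1 - x * w"
    have p: "p \<noteq> 0" using nz1 by (simp add: p_def)
    then have "1 - x * (1 / p) * C = (p - x * C) / p" by (simp add: field_simps)
    then have "x * (1 / p) / (1 - x * (1 / p) * C) = x / (p - x * C)" using p by simp
    then show ?thesis by (simp add: A2_def x_def[symmetric] C_def[symmetric] p_def)
  qed
  also have "\<dots> = x * C / (1 - x * w * C)"
    using mult_divide_mult_cancel_right[OF C0, of x "1 - x * w - x * C"] by (simp only: num)
  finally have A2L: "A2 (L_ser 0 w) = x * C / (1 - x * w * C)" .
  have "(1 + A2 (L_ser 0 w) - A2 1) * (1 - x * w * C) = (1 - x * C) * (1 - x * w * C) + x * C"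
  proof -
    have "(1 + b / p - d) * p = (1 - d) * p + b" if "p \<noteq> 0" for b d p :: "'a fls"
      using that by (simp add: algebra_simps)
    then show ?thesis unfolding A2L A1 using nz2 by blast
  qed
  also have "\<dots> = 1 - x * w * (C * (1 - x * C))" by (simp add: algebra_simps)
  also have "\<dots> = 1 - x * w" by (simp add: C1)
  finally have "1 + A2 (L_ser 0 w) - A2 1 = (1 - x * w) / (1 - x * w * C)"
    using nz2 by (simp add: field_simps)
  then show ?thesis
    using nz1 by (simp add: filling_gf_def A2_def x_def[symmetric] C_def[symmetric])
qed

lemma ord_ge_A2:
  assumes "ord_ge 0 (w :: 'a::field fls)"
  shows "ord_ge 0 (A2 w)"
proof -
  have "ord_ge 0 (x_ser * w * (1 / (1 - x_ser * (w * C_ser))))"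
    by (intro ord_ge_mult_integral[OF ord_ge_mono[OF ord_ge_x_mult[OF assms]]] one_minus_x_unit(2)
        ord_ge_mult_integral assms C_ser_integral) simp
  then show ?thesis by (simp add: A2_def mult.assoc)
qed

text \<open>
  Both sides solve the same equation, so their difference \<open>D\<close> satisfies
  \<open>D(w) = xwL (D(L) - D(1))\<close> for every power series \<open>w\<close>. If \<open>D\<close> takes only values of order at least \<open>n\<close>,
  the factor \<open>x\<close> raises this to \<open>n + 2\<close> (the order counts powers of \<open>\<surd>x\<close>); hence \<open>D = 0\<close>.
\<close>

lemma letter_gf_0_eq_A2:
  fixes w v :: "'a::field fls"
  assumes w: "ord_ge 0 w" and v: "ord_ge 0 v"
  shows "letter_gf 0 w v = A2 (v * w)"
proof -
  define D :: "'a fls \<Rightarrow> 'a fls" where "D = (\<lambda>u. letter_gf 0 u 1 - A2 u)"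
  \<comment> \<open>With \<open>v = 1\<close> no letter is marked, so the recursion in \<open>i\<close> becomes an equation.\<close>
  have indep: "letter_gf i u 1 = letter_gf 0 u 1" for i and u :: "'a fls"
    by (simp add: letter_gf_def word_weight_def[abs_def])
  have rec: "D u = filling_gf u * (D (L_ser 0 u) - D 1)" if "ord_ge 0 u" for u
  proof -
    have "D u = letter_gf (Suc 0) u 1 - A2 u"
      by (simp add: D_def indep[of "Suc 0"])
    also have "\<dots> = filling_gf u * (1 + letter_gf 0 (L_ser 0 u) 1 - letter_gf 0 1 1)
        - filling_gf u * (1 + A2 (L_ser 0 u) - A2 1)"
      by (intro arg_cong2[of _ _ _ _ "(-)"] letter_gf_Suc A2_functional that ord_ge_1)
    finally show ?thesis by (simp add: D_def algebra_simps)
  qed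
  have "ord_ge (int n) (D u)" if "ord_ge 0 u" for n u
    using that
  proof (induction n arbitrary: u)
    case 0
    then show ?case by (simp add: D_def ord_ge_diff ord_ge_letter_gf ord_ge_A2)
  next
    case (Suc n)
    have "ord_ge (2 + int n) (filling_gf u * (D (L_ser 0 u) - D 1))"
      using Suc by (intro ord_ge_mult ord_ge_filling_gf ord_ge_diff Suc.IH L_ser_integral) auto
    then have "ord_ge (int (Suc n)) (filling_gf u * (D (L_ser 0 u) - D 1))"
      by (rule ord_ge_mono) simp
    then show ?case using rec[OF Suc.prems] by simp
  qed
  then have "D (v * w) = 0"
    using assms by (intro ord_ge_imp_eq_0) (auto intro: ord_ge_mult_integral)
  moreover have "letter_gf 0 w v = letter_gf 0 (v * w) 1"
    by (simp add: letter_gf_def word_weight_def[abs_def] power_mult_distrib mult_ac)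
  ultimately show ?thesis by (simp add: D_def)
qed

text \<open>
  Setting \<open>v = 0\<close> keeps exactly the words that avoid the letter \<open>i\<close>.
\<close>

definition marked_gf :: "nat \<Rightarrow> 'a::field fls \<Rightarrow> 'a fls \<Rightarrow> 'a fls" where
  "marked_gf i w v = letter_gf i w v - letter_gf i w 0"

lemma marked_gf_has_sum:
  assumes "ord_ge 0 w" "ord_ge 0 (v :: 'a::field fls)"
  shows "(word_weight i w v has_sum marked_gf i w v) {a \<in> nonempty_words. i \<in> set a}"
proof -
  have "((\<lambda>a. word_weight i w v a - word_weight i w 0 a) has_sum marked_gf i w v) nonempty_words"
    unfolding marked_gf_def using assms by (intro has_sum_diff letter_gf_has_sum) auto
  then show ?thesis
    by (rule has_sum_cong_neutral[THEN iffD1, rotated -1])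
      (auto simp: word_weight_def count_list_0_iff power_0_left)
qed

lemma marked_gf_Suc:
  assumes "ord_ge 0 w" "ord_ge 0 (v :: 'a::field fls)"
  shows "marked_gf (Suc i) w v = filling_gf w * (marked_gf i (L_ser 0 w) v - marked_gf i 1 v)"
  unfolding marked_gf_def letter_gf_Suc[OF assms] letter_gf_Suc[OF assms(1) ord_ge_0] by (simp add: algebra_simps)

lemma marked_gf_0:
  assumes "ord_ge 0 w" "ord_ge 0 (v :: 'a::field fls)"
  shows "marked_gf 0 w v = A2 (v * w)"
  using letter_gf_0_eq_A2[OF assms] letter_gf_0_eq_A2[OF assms(1) ord_ge_0] by (simp add: marked_gf_def A2_def)

text \<open>
  The pair \<open>(i, a)\<close> stands for the word \<open>a\<close> with the letter \<open>Suc i\<close> marked. Summing over these pairs in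
  two ways links \<open>A4\<close>, which groups them by the statistics \<open>(i, s, t, n)\<close>, to the series for a fixed letter.
\<close>

definition marked_words :: "(nat \<times> nat list) set" where
  "marked_words = (SIGMA i:UNIV. {a \<in> nonempty_words. Suc i \<in> set a})"

lemma marked_words_summable:
  fixes w v q :: "'a::field fls"
  assumes w: "ord_ge 0 w" and v: "ord_ge 0 v" and q: "ord_ge 0 q"
  shows "(\<lambda>(i, a). q ^ Suc i * word_weight (Suc i) w v a) summable_on marked_words"
proof (rule fls_summable_onI)
  have ord: "ord_ge (int (2 * length a)) (q ^ Suc i * word_weight (Suc i) w v a)" for i a
    using ord_ge_word_weight[OF w v] ord_ge_power[OF q] by (intro ord_ge_mult_integral)
  show "ord_ge 0 (case p of (i, a) \<Rightarrow> q ^ Suc i * word_weight (Suc i) w v a)" for p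
    using ord_ge_mono[OF ord] by (cases p) auto
  fix N
  have len: "length a \<le> N" if "\<not> ord_ge (int N) (q ^ Suc i * word_weight (Suc i) w v a)" for i a
    using that ord_ge_mono[OF ord[of a i], of "int N"] by linarith
  have "{p \<in> marked_words. \<not> ord_ge (int N) (case p of (i, a) \<Rightarrow> q ^ Suc i * word_weight (Suc i) w v a)}
      \<subseteq> {..N} \<times> {a \<in> nonempty_words. length a \<le> N}"
  proof safe
    fix i a assume m: "(i, a) \<in> marked_words" and o: "\<not> ord_ge (int N) (q ^ Suc i * word_weight (Suc i) w v a)"
    show "a \<in> nonempty_words" using m by (simp add: marked_words_def)
    show "length a \<le> N" using len[OF o] .
    have "Suc i \<le> length a" using m by (intro letter_le_length) (auto simp: marked_words_def)
    then show "i \<le> N" using len[OF o] by linarith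
  qed
  then show "finite {p \<in> marked_words. \<not> ord_ge (int N) (case p of (i, a) \<Rightarrow> q ^ Suc i * word_weight (Suc i) w v a)}"
    by (rule finite_subset) (use finite_nonempty_words in auto)
qed

lemma A4_term_has_sum:
  fixes w v q :: "'a::field fls"
  assumes w: "ord_ge 0 w" and v: "ord_ge 0 v" and q: "ord_ge 0 q"
  shows "(A4_term w v q has_sum infsum (\<lambda>(i, a). q ^ Suc i * word_weight (Suc i) w v a) marked_words) A4_index"
proof -
  define S where "S = infsum (\<lambda>(i, a). q ^ Suc i * word_weight (Suc i) w v a) marked_words"
  define fib where "fib = (\<lambda>(i, s, t, n). {a \<in> words_L n. count_list a i = s \<and> count_list a 0 = t})"
  define h where "h = (\<lambda>((i :: nat, s :: nat, t :: nat, n :: nat), a). q ^ i * word_weight i w v a)"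
  have S: "((\<lambda>(i, a). q ^ Suc i * word_weight (Suc i) w v a) has_sum S) marked_words"
    unfolding S_def using marked_words_summable[OF assms] by simp
  have "(h has_sum S) (Sigma A4_index fib)"
  proof -
    define forget :: "(nat \<times> nat \<times> nat \<times> nat) \<times> nat list \<Rightarrow> nat \<times> nat list"
      where "forget = (\<lambda>((i, s, t, n), a). (i - 1, a))"
    define stats :: "nat \<times> nat list \<Rightarrow> (nat \<times> nat \<times> nat \<times> nat) \<times> nat list"
      where "stats = (\<lambda>(i, a). ((Suc i, count_list a (Suc i), count_list a 0, length a), a))"
    have 1: "forget p \<in> marked_words \<and> stats (forget p) = p \<and>
        (case forget p of (i, a) \<Rightarrow> q ^ Suc i * word_weight (Suc i) w v a) = h p"
      if p: "p \<in> Sigma A4_index fib" for p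
    proof -
      obtain i s t n a where p_eq: "p = ((i, s, t, n), a)" by (metis prod.exhaust)
      have i: "1 \<le> i" "1 \<le> s" and a: "length a = n" "L_word a" "count_list a i = s" "count_list a 0 = t"
        using p by (auto simp: p_eq A4_index_def fib_def words_L_iff_L_word)
      have "i \<in> set a" using i a count_list_0_iff[of a i] by auto
      moreover obtain m where "i = Suc m" using i by (cases i) auto
      ultimately show ?thesis
        using i a by (auto simp: p_eq forget_def stats_def h_def marked_words_def nonempty_words_def)
    qed
    have 2: "stats p \<in> Sigma A4_index fib \<and> forget (stats p) = p" if p: "p \<in> marked_words" for p
    proof -
      obtain i a where p_eq: "p = (i, a)" by (cases p)
      have a: "L_word a" "Suc i \<in> set a" "0 \<in> set a"
        using p zero_in_word[of a] by (auto simp: p_eq marked_words_def nonempty_words_def)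
      have "count_list a (Suc i) \<noteq> 0" "count_list a 0 \<noteq> 0" using a by (auto simp: count_list_0_iff)
      then show ?thesis
        using L_word_length_bound[OF a(1,2)] a
        by (auto simp: p_eq stats_def forget_def A4_index_def fib_def words_L_iff_L_word)
    qed
    show ?thesis
      by (rule has_sum_reindex_bij_witness[where T = marked_words and j = forget and i = stats, THEN iffD2])
        (use 1 2 S in auto)
  qed
  moreover have "((\<lambda>a. h (p, a)) has_sum A4_term w v q p) (fib p)" if "p \<in> A4_index" for p
  proof -
    obtain i s t n where p: "p = (i, s, t, n)" by (metis prod.exhaust)
    have "finite (words_L n)"
    proof (cases n)
      case 0
      have "words_L 0 \<subseteq> {[]}" by (auto simp: words_L_def)
      then show ?thesis using 0 finite_subset by blast
    next
      case (Suc m)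
      show ?thesis
        by (rule finite_subset[OF _ finite_nonempty_words[of n]]) (auto simp: words_L_iff_L_word nonempty_words_def Suc)
    qed
    then have fin: "finite (fib p)" by (simp add: fib_def p)
    have "(\<Sum>a\<in>fib p. h (p, a)) = (\<Sum>a\<in>fib p. x_ser ^ n * w ^ t * v ^ s * q ^ i)"
      by (intro sum.cong) (auto simp: fib_def p h_def word_weight_def words_L_iff_L_word)
    also have "\<dots> = A4_term w v q p"
      by (simp add: A4_term_def p fib_def num_words_def mult.assoc)
    finally show ?thesis using fin by (intro has_sum_finiteI) auto
  qed
  ultimately have "(A4_term w v q has_sum S) A4_index"
    by (rule has_sum_SigmaD)
  then show ?thesis by (simp add: S_def)
qed

lemma A4_has_sum:
  fixes w v q :: "'a::field fls"
  assumes w: "ord_ge 0 w" and v: "ord_ge 0 v" and q: "ord_ge 0 q"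
  shows "((\<lambda>i. q ^ Suc i * marked_gf (Suc i) w v) has_sum A4 w v q) UNIV"
proof -
  have "A4 w v q = infsum (\<lambda>(i, a). q ^ Suc i * word_weight (Suc i) w v a) marked_words"
    unfolding A4_def by (rule infsumI) (rule A4_term_has_sum[OF assms])
  then have "((\<lambda>(i, a). q ^ Suc i * word_weight (Suc i) w v a) has_sum A4 w v q)
      (SIGMA i:UNIV. {a \<in> nonempty_words. Suc i \<in> set a})"
    using marked_words_summable[OF assms] by (simp add: marked_words_def)
  then show ?thesis
    by (rule has_sum_SigmaD) (use marked_gf_has_sum[OF w v] in \<open>auto intro: has_sum_cmult_right\<close>)
qed

lemma has_sum_nat_shift:
  fixes f :: "nat \<Rightarrow> 'a::topological_comm_monoid_add"
  assumes "((\<lambda>i. f (Suc i)) has_sum s) UNIV"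
  shows "(f has_sum (f 0 + s)) UNIV"
proof -
  have "(f has_sum s) (range Suc)"
    using assms by (subst has_sum_reindex) (auto simp: o_def)
  from has_sum_insert[OF _ this, of 0] show ?thesis by (simp flip: UNIV_nat_eq)
qed

text \<open>
  Multiply the recursion for the marked letter by \<open>q\<^sup>i\<^sup>+\<^sup>1\<close> and sum over \<open>i \<ge> 0\<close>; the term of the letter
  \<open>0\<close> on the right-hand side is \<open>A(x,vu)\<close> with \<open>u = L\<^sub>0\<close> and \<open>u = 1\<close>.
\<close>

lemma A4_functional:
  fixes w v q :: "'a::field fls"
  assumes w: "ord_ge 0 w" and v: "ord_ge 0 v" and q: "ord_ge 0 q"
  shows "A4 w v q = q * filling_gf w * (A2 (v * L_ser 0 w) - A2 v + A4 (L_ser 0 w) v q - A4 1 v q)"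
proof -
  have E: "((\<lambda>i. q ^ i * marked_gf i u v) has_sum (A2 (v * u) + A4 u v q)) UNIV" if "ord_ge 0 u" for u
    using has_sum_nat_shift[OF A4_has_sum[OF that v q]] marked_gf_0[OF that v] by simp
  have "((\<lambda>i. q * filling_gf w * (q ^ i * marked_gf i (L_ser 0 w) v - q ^ i * marked_gf i 1 v)) has_sum
      q * filling_gf w * (A2 (v * L_ser 0 w) + A4 (L_ser 0 w) v q - (A2 (v * 1) + A4 1 v q))) UNIV"
    by (intro has_sum_cmult_right has_sum_diff E L_ser_integral w ord_ge_1)
  moreover have "(\<lambda>i. q * filling_gf w * (q ^ i * marked_gf i (L_ser 0 w) v - q ^ i * marked_gf i 1 v)) =
      (\<lambda>i. q ^ Suc i * marked_gf (Suc i) w v)"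
    by (simp add: marked_gf_Suc[OF w v] algebra_simps)
  ultimately show ?thesis
    using has_sum_unique[OF A4_has_sum[OF assms]] by (simp add: algebra_simps)
qed

lemma ord_ge_A4:
  fixes w v q :: "'a::field fls"
  assumes w: "ord_ge 0 w" and v: "ord_ge 0 v" and q: "ord_ge 0 q"
  shows "ord_ge 0 (A4 w v q)"
proof (rule has_sum_ord_ge[OF A4_has_sum[OF assms]])
  show "ord_ge 0 (q ^ Suc i * marked_gf (Suc i) w v)" for i
    unfolding marked_gf_def using assms by (intro ord_ge_mult_integral ord_ge_power ord_ge_diff ord_ge_letter_gf) auto
qed

section \<open>Continued fraction and Chebyshev polynomials\<close>

lemma chebyshev_U_rec:
  assumes t: "2 * t * y = (1 :: 'a::field)"
  shows "y * chebyshev_U (int (Suc n)) t = chebyshev_U (int n) t - y * chebyshev_U (int n - 1) t"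
proof (cases n)
  case 0
  then show ?thesis using t by (simp add: chebyshev_U_def mult.commute)
next
  case (Suc m)
  have "nat (2 + int m) = Suc (Suc m)" "nat (1 + int m) = Suc m" by auto
  moreover have "y * (2 * t * u) = u" for u using t by (metis mult.assoc mult.commute mult_1)
  ultimately show ?thesis by (simp add: Suc chebyshev_U_def right_diff_distrib)
qed

text \<open>
  The series \<open>D\<^sub>j = U\<^sub>j - w\<surd>x U\<^sub>j\<^sub>-\<^sub>1\<close>: up to powers of \<open>\<surd>x\<close>, the denominators of the continued fraction
  \<open>L\<^sub>j\<^sub>-\<^sub>1(x,w)\<close>.
\<close>

definition convergent_denom :: "'a::field fls \<Rightarrow> 'a fls \<Rightarrow> nat \<Rightarrow> 'a fls" where
  "convergent_denom t w j = chebyshev_U (int j) t - w * sqrt_x * chebyshev_U (int j - 1) t"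

lemma convergent_denom_0: "convergent_denom t w 0 = 1"
  by (simp add: convergent_denom_def chebyshev_U_def)

lemma convergent_denom_1:
  assumes t: "2 * t * sqrt_x = (1 :: 'a::field fls)"
  shows "sqrt_x * convergent_denom t w (Suc 0) = 1 - x_ser * w"
  using chebyshev_U_rec[OF t, of 0]
  by (simp add: convergent_denom_def chebyshev_U_def x_ser_def power2_eq_square algebra_simps)

lemma convergent_denom_rec:
  assumes t: "2 * t * sqrt_x = (1 :: 'a::field fls)"
  shows "sqrt_x * convergent_denom t w (Suc (Suc j)) =
    convergent_denom t w (Suc j) - sqrt_x * convergent_denom t w j"
proof -
  define U where "U = (\<lambda>k. chebyshev_U k t)"
  have 1: "sqrt_x * U (int j + 2) = U (int j + 1) - sqrt_x * U (int j)"
    using chebyshev_U_rec[OF t, of "Suc j"] by (simp add: U_def add.commute)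
  have 2: "sqrt_x * U (int j + 1) = U (int j) - sqrt_x * U (int j - 1)"
    using chebyshev_U_rec[OF t, of j] by (simp add: U_def add.commute)
  have "sqrt_x * convergent_denom t w (Suc (Suc j)) =
      sqrt_x * U (int j + 2) - w * sqrt_x * (sqrt_x * U (int j + 1))"
    by (simp add: convergent_denom_def U_def algebra_simps)
  also have "\<dots> = (U (int j + 1) - w * sqrt_x * U (int j)) - sqrt_x * (U (int j) - w * sqrt_x * U (int j - 1))"
    unfolding 1 2 by (simp add: algebra_simps)
  finally show ?thesis by (simp add: convergent_denom_def U_def add.commute)
qed

lemma convergent_denom_at_1:
  assumes t: "2 * t * sqrt_x = (1 :: 'a::field fls)"
  shows "convergent_denom t 1 j = sqrt_x * chebyshev_U (int j + 1) t"
  using chebyshev_U_rec[OF t, of j] by (simp add: convergent_denom_def add.commute)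

lemma sqrt_x_neq_0 [simp]: "sqrt_x \<noteq> (0 :: 'a::field fls)"
  by (simp add: sqrt_x_def)

text \<open>
  Since \<open>\<surd>x D\<^sub>j\<^sub>+\<^sub>2 = D\<^sub>j\<^sub>+\<^sub>1 - \<surd>x D\<^sub>j = D\<^sub>j\<^sub>+\<^sub>1 (1 - x L\<^sub>j)\<close> and \<open>1 - x L\<^sub>j\<close> is a unit, the nonvanishing
  of the denominators and the formula for \<open>L\<^sub>j\<close> propagate together.
\<close>

lemma L_ser_convergent:
  fixes w :: "'a::field fls"
  assumes t: "2 * t * sqrt_x = 1" and w: "ord_ge 0 w"
  shows "convergent_denom t w (Suc j) \<noteq> 0 \<and> convergent_denom t w j \<noteq> 0 \<and>
     L_ser j w = convergent_denom t w j / (sqrt_x * convergent_denom t w (Suc j))"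
proof (induction j)
  case 0
  then show ?case
    using one_minus_x_unit(1)[OF w] convergent_denom_1[OF t, of w] by (auto simp: convergent_denom_0)
next
  case (Suc j)
  define d where "d = convergent_denom t w"
  have nz: "d (Suc j) \<noteq> 0" and L: "L_ser j w = d j / (sqrt_x * d (Suc j))"
    using Suc by (auto simp: d_def)
  have "sqrt_x * d (Suc (Suc j)) = d (Suc j) - sqrt_x * d j"
    unfolding d_def by (rule convergent_denom_rec[OF t])
  also have "\<dots> = d (Suc j) * (1 - x_ser * L_ser j w)"
    using nz by (simp add: L x_ser_def power2_eq_square right_diff_distrib)
  finally have eq: "sqrt_x * d (Suc (Suc j)) = d (Suc j) * (1 - x_ser * L_ser j w)" .
  have unit: "1 - x_ser * L_ser j w \<noteq> 0"
    by (intro one_minus_x_unit(1) L_ser_integral w)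
  have "d (Suc (Suc j)) \<noteq> 0" using eq unit nz by auto
  moreover have "L_ser (Suc j) w = d (Suc j) / (sqrt_x * d (Suc (Suc j)))"
    unfolding eq using nz by simp
  ultimately show ?case using nz by (simp add: d_def)
qed

text \<open>
  The product of the factors \<open>x u u'\<close> over the first \<open>j + 1\<close> steps \<open>u \<mapsto> u'\<close> of the iteration
  \<open>w \<mapsto> L\<^sub>0 \<mapsto> L\<^sub>1 \<mapsto> \<dots>\<close>; it telescopes to this quotient.
\<close>

definition iteration_weight :: "'a::field fls \<Rightarrow> 'a fls \<Rightarrow> nat \<Rightarrow> 'a fls" where
  "iteration_weight t w j = w * sqrt_x / (convergent_denom t w (Suc j) * convergent_denom t w j)"

lemma iteration_weight_0:
  fixes w :: "'a::field fls"
  assumes t: "2 * t * sqrt_x = 1" and w: "ord_ge 0 w"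
  shows "iteration_weight t w 0 = filling_gf w"
  using L_ser_convergent[OF t w, of 0]
  by (simp add: iteration_weight_def filling_gf_def convergent_denom_0 x_ser_def power2_eq_square del: L_ser.simps)

lemma iteration_weight_Suc:
  fixes w :: "'a::field fls"
  assumes t: "2 * t * sqrt_x = 1" and w: "ord_ge 0 w"
  shows "iteration_weight t w (Suc j) = iteration_weight t w j * filling_gf (L_ser j w)"
proof -
  define d where "d = convergent_denom t w"
  have nz: "d j \<noteq> 0" "d (Suc j) \<noteq> 0" "d (Suc (Suc j)) \<noteq> 0"
    using L_ser_convergent[OF t w, of j] L_ser_convergent[OF t w, of "Suc j"] by (auto simp: d_def)
  have "L_ser 0 (L_ser j w) = L_ser (Suc j) w" by simp
  then have "filling_gf (L_ser j w) = x_ser * L_ser j w * L_ser (Suc j) w"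
    by (simp only: filling_gf_def)
  also have "\<dots> = sqrt_x ^ 2 * (d j / (sqrt_x * d (Suc j))) * (d (Suc j) / (sqrt_x * d (Suc (Suc j))))"
    using L_ser_convergent[OF t w, of j] L_ser_convergent[OF t w, of "Suc j"]
    by (simp only: x_ser_def d_def)
  also have "\<dots> = d j / d (Suc (Suc j))"
    using nz by (simp add: power2_eq_square)
  finally show ?thesis using nz by (simp add: iteration_weight_def d_def)
qed

lemma ord_ge_iteration_weight:
  fixes w :: "'a::field fls"
  assumes t: "2 * t * sqrt_x = 1" and w: "ord_ge 0 w"
  shows "ord_ge (int (2 * Suc j)) (iteration_weight t w j)"
proof (induction j)
  case 0
  then show ?case using ord_ge_filling_gf[OF w] by (simp add: iteration_weight_0[OF t w])
next
  case (Suc j)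
  have "ord_ge (int (2 * Suc j) + 2) (iteration_weight t w j * filling_gf (L_ser j w))"
    by (intro ord_ge_mult Suc ord_ge_filling_gf L_ser_integral w)
  then show ?case by (simp add: iteration_weight_Suc[OF t w])
qed

lemma A4_iterate:
  fixes w v q :: "'a::field fls"
  assumes t: "2 * t * sqrt_x = 1" and w: "ord_ge 0 w" and v: "ord_ge 0 v" and q: "ord_ge 0 q"
  shows "A4 w v q = q * (\<Sum>j<Suc n. q ^ j * iteration_weight t w j * (A2 (v * L_ser j w) - A2 v - A4 1 v q))
     + q ^ Suc n * iteration_weight t w n * A4 (L_ser n w) v q"
proof (induction n)
  case 0
  show ?case
    using A4_functional[OF w v q] by (simp add: iteration_weight_0[OF t w] algebra_simps del: L_ser.simps)
next
  case (Suc n)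
  have "L_ser 0 (L_ser n w) = L_ser (Suc n) w" by simp
  then have step: "A4 (L_ser n w) v q = q * filling_gf (L_ser n w) *
      (A2 (v * L_ser (Suc n) w) - A2 v + A4 (L_ser (Suc n) w) v q - A4 1 v q)"
    using A4_functional[OF L_ser_integral[OF w] v q, of n] by (simp only:)
  have "q ^ Suc n * iteration_weight t w n * A4 (L_ser n w) v q =
      q ^ Suc n * iteration_weight t w n * (q * filling_gf (L_ser n w) *
      (A2 (v * L_ser (Suc n) w) - A2 v + A4 (L_ser (Suc n) w) v q - A4 1 v q))"
    by (rule arg_cong[OF step])
  also have "\<dots> = q * (q ^ Suc n * iteration_weight t w (Suc n) * (A2 (v * L_ser (Suc n) w) - A2 v - A4 1 v q))
      + q ^ Suc (Suc n) * iteration_weight t w (Suc n) * A4 (L_ser (Suc n) w) v q"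
    by (simp add: iteration_weight_Suc[OF t w] algebra_simps del: L_ser.simps)
  finally show ?case
    using Suc.IH by (simp add: distrib_left del: L_ser.simps)
qed

lemma iteration_weight_series_has_sum:
  fixes w q :: "'a::field fls"
  assumes t: "2 * t * sqrt_x = 1" and w: "ord_ge 0 w" and q: "ord_ge 0 q"
    and c: "\<And>j. ord_ge 0 (c j)"
  shows "((\<lambda>j. q ^ j * iteration_weight t w j * c j) has_sum (\<Sum>j. q ^ j * iteration_weight t w j * c j)) UNIV"
proof -
  have ord: "ord_ge (int (2 * Suc j)) (q ^ j * iteration_weight t w j * c j)" for j
    by (intro ord_ge_mult_integral' ord_ge_mult_integral ord_ge_iteration_weight t w c ord_ge_power q)
  have "(\<lambda>j. q ^ j * iteration_weight t w j * c j) summable_on UNIV"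
  proof (rule fls_summable_onI)
    show "ord_ge 0 (q ^ j * iteration_weight t w j * c j)" for j
      by (rule ord_ge_mono[OF ord]) simp
    fix N
    have "j \<le> N" if "\<not> ord_ge (int N) (q ^ j * iteration_weight t w j * c j)" for j
    proof (rule ccontr)
      assume "\<not> j \<le> N"
      then have "ord_ge (int N) (q ^ j * iteration_weight t w j * c j)"
        by (intro ord_ge_mono[OF ord[of j]]) simp
      with that show False by contradiction
    qed
    then show "finite {j \<in> UNIV. \<not> ord_ge (int N) (q ^ j * iteration_weight t w j * c j)}"
      by (intro finite_subset[OF _ finite_atMost[of N]]) blast
  qed
  then obtain S where S: "((\<lambda>j. q ^ j * iteration_weight t w j * c j) has_sum S) UNIV"
    unfolding summable_on_def by blast
  show ?thesis
    using S unfolding sums_unique[OF has_sum_imp_sums[OF S], symmetric] .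
qed

text \<open>
  The remainder after \<open>n + 1\<close> iterations contains the factor \<open>iteration_weight t w n\<close>, of order at least
  \<open>2n + 2\<close>, so it disappears in the limit.
\<close>

lemma A4_eq_series:
  fixes w v q :: "'a::field fls"
  assumes t: "2 * t * sqrt_x = 1" and w: "ord_ge 0 w" and v: "ord_ge 0 v" and q: "ord_ge 0 q"
  shows "A4 w v q = q * (\<Sum>j. q ^ j * iteration_weight t w j * (A2 (v * L_ser j w) - A2 v - A4 1 v q))"
proof -
  define T where "T = (\<lambda>j. q ^ j * iteration_weight t w j * (A2 (v * L_ser j w) - A2 v - A4 1 v q))"
  have "T sums (\<Sum>j. T j)"
    unfolding T_def
    by (intro has_sum_imp_sums iteration_weight_series_has_sum t w q ord_ge_diff ord_ge_A2 ord_ge_A4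
        ord_ge_mult_integral L_ser_integral v ord_ge_1)
  then have "(\<lambda>n. q * (\<Sum>j<Suc n. T j)) \<longlonglongrightarrow> q * (\<Sum>j. T j)"
    unfolding sums_def by (intro tendsto_mult_left LIMSEQ_Suc)
  moreover have "(\<lambda>n. q * (\<Sum>j<Suc n. T j)) \<longlonglongrightarrow> A4 w v q"
    unfolding tendsto_fls_iff
  proof (intro allI eventually_sequentiallyI)
    fix N :: int and n assume n: "nat N \<le> n"
    have "ord_ge (int (2 * Suc n)) (q ^ Suc n * iteration_weight t w n * A4 (L_ser n w) v q)"
      by (intro ord_ge_mult_integral' ord_ge_mult_integral ord_ge_iteration_weight ord_ge_A4 L_ser_integral
          ord_ge_power t w v q)
    then have "ord_ge N (- (q ^ Suc n * iteration_weight t w n * A4 (L_ser n w) v q))"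
      unfolding ord_ge_uminus by (rule ord_ge_mono) (use n in \<open>simp add: nat_le_iff\<close>)
    moreover have "q * (\<Sum>j<Suc n. T j) - A4 w v q = - (q ^ Suc n * iteration_weight t w n * A4 (L_ser n w) v q)"
      unfolding T_def by (subst A4_iterate[OF t w v q, of n])
        (simp only: diff_add_eq_diff_diff_swap diff_self diff_diff_eq2, simp)
    ultimately show "ord_ge N (q * (\<Sum>j<Suc n. T j) - A4 w v q)" by simp
  qed
  ultimately show ?thesis
    unfolding T_def by (rule LIMSEQ_unique[rotated])
qed

text \<open>
  At \<open>w = 1\<close> the series contains the unknown \<open>A(1)\<close> on both sides, linearly.
\<close>

lemma A4_at_1:
  fixes v q :: "'a::field fls"
  assumes t: "2 * t * sqrt_x = 1" and v: "ord_ge 0 v" and q: "ord_ge 0 q"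
  shows "A4 1 v q = q * (\<Sum>j. q ^ j * iteration_weight t 1 j * (A2 (v * L_ser j 1) - A2 v)) /
     (1 + q * (\<Sum>j. q ^ j * iteration_weight t 1 j * 1))"
proof -
  define H where "H = A4 1 v q"
  define S where "S = (\<Sum>j. q ^ j * iteration_weight t 1 j * (A2 (v * L_ser j 1) - A2 v))"
  define R where "R = (\<Sum>j. q ^ j * iteration_weight t 1 j * 1)"
  have S: "((\<lambda>j. q ^ j * iteration_weight t 1 j * (A2 (v * L_ser j 1) - A2 v)) has_sum S) UNIV"
    unfolding S_def
    by (intro iteration_weight_series_has_sum t q ord_ge_1 ord_ge_diff ord_ge_A2 ord_ge_mult_integral L_ser_integral v)
  have R: "((\<lambda>j. q ^ j * iteration_weight t 1 j * 1) has_sum R) UNIV"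
    unfolding R_def by (intro iteration_weight_series_has_sum t q ord_ge_1)
  have "((\<lambda>j. q ^ j * iteration_weight t 1 j * (A2 (v * L_ser j 1) - A2 v) - H * (q ^ j * iteration_weight t 1 j * 1)) has_sum
      (S - H * R)) UNIV"
    by (intro has_sum_diff has_sum_cmult_right S R)
  then have "((\<lambda>j. q ^ j * iteration_weight t 1 j * (A2 (v * L_ser j 1) - A2 v - H)) has_sum (S - H * R)) UNIV"
    by (rule has_sum_cong[THEN iffD1, rotated]) (simp add: algebra_simps)
  then have "(\<Sum>j. q ^ j * iteration_weight t 1 j * (A2 (v * L_ser j 1) - A2 v - H)) = S - H * R"
    by (intro sums_unique[symmetric] has_sum_imp_sums)
  then have "H = q * (S - H * R)"
    using A4_eq_series[OF t ord_ge_1 v q] by (simp only: H_def)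
  then have "H * (1 + q * R) = q * S" by (simp add: algebra_simps)
  moreover have "1 + q * R \<noteq> 0"
  proof -
    have "ord_ge 1 (q ^ j * iteration_weight t 1 j * 1)" for j
      by (rule ord_ge_mono[of "int (2 * Suc j)"], intro ord_ge_mult_integral' ord_ge_mult_integral
          ord_ge_iteration_weight t q ord_ge_power ord_ge_1) simp
    then have "ord_ge 1 R" by (intro has_sum_ord_ge[OF R])
    then have "ord_ge 1 (- (q * R))"
      unfolding ord_ge_uminus by (intro ord_ge_mult_integral q)
    from one_minus_unit(1)[OF this] show ?thesis by simp
  qed
  ultimately show ?thesis by (simp add: H_def S_def R_def nonzero_eq_divide_eq)
qed

lemma iteration_weight_at_1:
  assumes t: "2 * t * sqrt_x = (1 :: 'a::field fls)"
  shows "iteration_weight t 1 j = 1 / (sqrt_x * chebyshev_U (int j + 2) t * chebyshev_U (int j + 1) t)"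
  by (simp add: iteration_weight_def convergent_denom_at_1[OF t] add.commute)

theorem theorem3p2:
  fixes w v q t :: "coeff_field fls"
    and num den outer :: "nat \<Rightarrow> coeff_field fls"
  assumes "w = w_var" and "v = v_var" and "q = q_var"
    and "t = 1 / (2 * sqrt_x)"
    and "num = (\<lambda>i. q ^ i * (A2 (v * L_ser i 1) - A2 v) /
                 (sqrt_x * chebyshev_U (int i + 2) t * chebyshev_U (int i + 1) t))"
    and "den = (\<lambda>i. q ^ i /
                 (sqrt_x * chebyshev_U (int i + 2) t * chebyshev_U (int i + 1) t))"
    and "outer = (\<lambda>j. w * sqrt_x * q ^ j *
                 (A2 (v * L_ser j w) - A2 v - q * (\<Sum>i. num i) / (1 + q * (\<Sum>i. den i))) /
                 ((chebyshev_U (int j + 1) t - w * sqrt_x * chebyshev_U (int j) t) *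
                  (chebyshev_U (int j) t - w * sqrt_x * chebyshev_U (int j - 1) t)))"
  shows "A4_term w v q summable_on A4_index \<and>
         summable num \<and> summable den \<and> summable outer \<and>
         A4 w v q = q * (\<Sum>j. outer j)"
proof -
  have w: "ord_ge 0 w" and v: "ord_ge 0 v" and q: "ord_ge 0 q"
    by (simp_all add: assms(1-3) w_var_def v_var_def q_var_def)
  have "(2 :: coeff_field fls) \<noteq> 0" by simp
  then have t: "2 * t * sqrt_x = 1" by (simp add: assms(4))
  have num: "num = (\<lambda>j. q ^ j * iteration_weight t 1 j * (A2 (v * L_ser j 1) - A2 v))"
    by (simp add: assms(5) iteration_weight_at_1[OF t])
  have den: "den = (\<lambda>j. q ^ j * iteration_weight t 1 j * 1)"
    by (simp add: assms(6) iteration_weight_at_1[OF t])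
  have H: "q * (\<Sum>i. num i) / (1 + q * (\<Sum>i. den i)) = A4 1 v q"
    unfolding num den A4_at_1[OF t v q] ..
  have outer: "outer = (\<lambda>j. q ^ j * iteration_weight t w j * (A2 (v * L_ser j w) - A2 v - A4 1 v q))"
    unfolding assms(7) H iteration_weight_def convergent_denom_def by (simp add: add.commute mult_ac)
  have "summable num"
    unfolding num
    by (intro summable_on_imp_summable has_sum_imp_summable[OF iteration_weight_series_has_sum] t q ord_ge_1
        ord_ge_diff ord_ge_A2 ord_ge_mult_integral L_ser_integral v)
  moreover have "summable den"
    unfolding den
    by (intro summable_on_imp_summable has_sum_imp_summable[OF iteration_weight_series_has_sum] t q ord_ge_1)
  moreover have "summable outer"
    unfolding outer
    by (intro summable_on_imp_summable has_sum_imp_summable[OF iteration_weight_series_has_sum] t q w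
        ord_ge_diff ord_ge_A2 ord_ge_A4 ord_ge_mult_integral L_ser_integral v ord_ge_1)
  moreover have "A4 w v q = q * (\<Sum>j. outer j)"
    unfolding outer by (rule A4_eq_series[OF t w v q])
  moreover have "A4_term w v q summable_on A4_index"
    by (rule has_sum_imp_summable[OF A4_term_has_sum[OF w v q]])
  ultimately show ?thesis by blast
qed

end
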